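(* Let $(a,b)\in\Omega$ be an irrational point (i.e. $b/a\notin\mathbb{Q}$), and for $n\ge 1$ let $f_n=\sum_{i=1}^n\left(k_i(a,b)-3\right)$. Let $e^+=e^+(b/a)$ and $e^-=e^-(b/a)$ be the even and odd Diophantine exponents of $b/a$, respectively. Then $$\limsup_{n\rightarrow+\infty}\frac{\log|f_n|}{\log n}=\max\left\{\frac{e^--1}{e^-},\frac{e^+-2}{e^+}\right\}.$$
   Context: The BCZ triangle (Farey triangle) is $\Omega=\{(a,b)\in\mathbb{R}^2 : a,b\in(0,1],\ a+b>1\}$. With $[x]$ denoting the integer part (floor) of $x$, the itinerary function is $k(a,b)=\left[\frac{1+a}{b}\right]$ and the BCZ map $T:\Omega\to\Omega$ is the bijection $T(a,b)=\left(b,-a+\left[\frac{1+a}{b}\right]b\right)$. For $n\in\mathbb{Z}$, $k_n(a,b):=k(T^{n-1}(a,b))$. A point $(a,b)\in\Omega$ is called irrational if $b/a$ is irrational. For an irrational number $s$, the even Diophantine exponent $e^+(s)$ is the supremum of all $v\in\mathbb{R}$ such that $0<\frac pq-s<\frac1{q^v}$ has infinitely many solutions $\frac pq\in\mathbb{Q}$, and the odd Diophantine exponent $e^-(s)$ is the supremum of all $v\in\mathbb{R}$ such that $0<s-\frac pq<\frac1{q^v}$ has infinitely many solutions $\frac pq\in\mathbb{Q}$ (here $p/q$ is in lowest terms with $q\ge1$). These are elements of $[2,+\infty]$; if an exponent $e^{\pm}$ is $+\infty$, the fractions $\frac{e^\pm-1}{e^\pm}$ and $\frac{e^\pm-2}{e^\pm}$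 are read as $1$. Also $\log 0=-\infty$. *)

theory Defs
  imports "HOL-Analysis.Analysis"
begin

definition farey_triangle :: "(real \<times> real) set" where
  "farey_triangle = {(a, b). 0 < a \<and> a \<le> 1 \<and> 0 < b \<and> b \<le> 1 \<and> a + b > 1}"

definition bcz_k :: "real \<times> real \<Rightarrow> int" where
  "bcz_k = (\<lambda>(a, b). \<lfloor>(1 + a) / b\<rfloor>)"

(* A total function on the plane; only its values on the Farey triangle,
   which it maps bijectively onto itself, are meaningful. *)
definition bcz_map :: "real \<times> real \<Rightarrow> real \<times> real" where
  "bcz_map = (\<lambda>(a, b). (b, - a + of_int (bcz_k (a, b)) * b))"

(* The n-th itinerary entry k_n, meant for n \<ge> 1 only, so that no iterate of the
   inverse map is involved. *)
definition bcz_itinerary :: "nat \<Rightarrow> real \<times> real \<Rightarrow> int" where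
  "bcz_itinerary n p = bcz_k ((bcz_map ^^ (n - 1)) p)"

definition bcz_sum :: "real \<times> real \<Rightarrow> nat \<Rightarrow> int" where
  "bcz_sum p n = (\<Sum>i = 1..n. bcz_itinerary i p - 3)"

definition reduced_denom :: "rat \<Rightarrow> int" where
  "reduced_denom r = snd (quotient_of r)"

definition even_dioph_exponent :: "real \<Rightarrow> ereal" where
  "even_dioph_exponent s =
     Sup {ereal v | v. infinite {r :: rat. 0 < of_rat r - s \<and>
                         of_rat r - s < 1 / of_int (reduced_denom r) powr v}}"

definition odd_dioph_exponent :: "real \<Rightarrow> ereal" where
  "odd_dioph_exponent s =
     Sup {ereal v | v. infinite {r :: rat. 0 < s - of_rat r \<and>
                         s - of_rat r < 1 / of_int (reduced_denom r) powr v}}"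

(* (e - c) / e, read as 1 at e = \<infinity>; the ereal quotient \<infinity> / \<infinity> would be 0. *)
definition exponent_ratio :: "ereal \<Rightarrow> ereal \<Rightarrow> ereal" where
  "exponent_ratio c e = (if e = \<infinity> then 1 else (e - c) / e)"

(* log |x| with log 0 = -\<infinity>, whereas ln 0 = 0 in the library. *)
definition log_abs :: "real \<Rightarrow> ereal" where
  "log_abs x = (if x = 0 then - \<infinity> else ereal (ln \<bar>x\<bar>))"

end

theory Submission
  imports Defs
begin

text \<open>
  The first coordinates of the orbit are \<open>x n = q n * b - p n * a\<close>, where the vectors
  \<open>v n = (q n, p n)\<close> start with \<open>(0, -1), (1, 0)\<close> and satisfy the same recursion as \<open>x\<close>; they
  are the primitive vectors with \<open>0 < x \<le> 1\<close>, ordered by slope, and neighbours have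
  determinant 1. The sum \<open>\<Sum>(k - 3)\<close> is invariant under inserting a mediant, so it is computed
  by the Stern--Brocot path to the Farey interval \<open>(v n, v (n + 1))\<close>: up to the constant \<open>-3\<close> it
  is the number of left moves minus the number of right moves, i.e. an alternating sum of
  partial quotients.

  Let \<open>X n = q n / x n\<close>. Then \<open>X (n + 1) - X n = a / (x n * x (n + 1))\<close>, and \<open>X n\<close> is
  comparable to \<open>n\<close>. A run of \<open>j\<close> equal moves around a vertex \<open>(u, v)\<close> of height
  \<open>h = u * b - v * a\<close> satisfies \<open>j \<lesssim> 1 / h\<close> and \<open>j \<lesssim> X n / u\<close> if \<open>h > 0\<close>, and
  \<open>j \<lesssim> 1 / (u * \<bar>h\<bar>)\<close> and \<open>j \<lesssim> X n / u\<^sup>2\<close> if \<open>h < 0\<close>. Interpolating between the two bounds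
  yields the exponents \<open>(e - 1) / e\<close> and \<open>(e - 2) / e\<close>, and there are only \<open>O(log n)\<close> runs.

  Conversely, a good approximation \<open>v n\<close> from below makes \<open>k\<^sub>n = f n - f (n - 1) + 3\<close> large, and a
  good approximation from above is the pivot of a long run of right moves, at both ends of which
  the value along the path is seen by the averages of \<open>f n\<close> and \<open>f (n - 1)\<close>.
\<close>

section \<open>Stern-Brocot pairs and the signed length of their paths\<close>

text \<open>Vectors are (denominator, numerator); the root has slopes 0 and infinity. The counter
  starts at \<open>-3\<close> because \<open>K 0\<close> left moves lead from the root to the first
  orbit pair, where the sum is \<open>K 0 - 3\<close>.\<close>

inductive stern_brocot :: "int \<Rightarrow> int \<Rightarrow> int \<Rightarrow> int \<Rightarrow> int \<Rightarrow> bool" where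
  base: "stern_brocot 1 0 0 1 (- 3)"
| left: "stern_brocot q p q' p' g \<Longrightarrow> stern_brocot q p (q + q') (p + p') (g + 1)"
| right: "stern_brocot q p q' p' g \<Longrightarrow> stern_brocot (q + q') (p + p') q' p' (g - 1)"

definition farey_basis :: "int \<Rightarrow> int \<Rightarrow> int \<Rightarrow> int \<Rightarrow> bool" where
  "farey_basis q p q' p' \<longleftrightarrow> 0 \<le> q \<and> 0 \<le> p \<and> 0 \<le> q' \<and> 0 \<le> p' \<and> q * p' - q' * p = 1"

lemma farey_basis_pos:
  assumes "farey_basis q p q' p'"
  shows "0 < q" "0 < p'"
  using assms unfolding farey_basis_def
  by (metis diff_0 int_one_le_iff_zero_less less_eq_int_code(1) less_le_not_le linorder_not_less
      mult_eq_0_iff mult_nonneg_nonneg neg_0_le_iff_le not_one_le_zero order_le_less zero_less_one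
      diff_le_0_iff_le mult_minus_left)+

lemma stern_brocot_basis: "stern_brocot q p q' p' g \<Longrightarrow> farey_basis q p q' p'"
  by (induction rule: stern_brocot.induct) (auto simp: farey_basis_def algebra_simps)

lemma stern_brocot_left_iter:
  assumes "stern_brocot q p q' p' g" "0 \<le> k"
  shows "stern_brocot q p (q' + k * q) (p' + k * p) (g + k)"
  using assms(2)
proof (induction k rule: int_ge_induct)
  case base
  then show ?case using assms(1) by simp
next
  case (step k)
  show ?case using left[OF step.IH] by (simp add: algebra_simps)
qed

text \<open>This is the invariance under inserting a mediant, by induction on the path. After a last
  left move the next pair is reached from the parent by one right move and \<open>k - 1\<close> left
  moves; after a last right move the parent satisfies the claim with \<open>k - 1\<close>. At the
  root the bound on \<open>k * q' - q\<close> fails.\<close>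

lemma stern_brocot_step:
  assumes "stern_brocot q p q' p' g" "0 \<le> k * q' - q" "0 \<le> k * p' - p"
  shows "stern_brocot q' p' (k * q' - q) (k * p' - p) (g + k - 3)"
  using assms
proof (induction arbitrary: k rule: stern_brocot.induct)
  case base
  then show ?case by simp
next
  case (left q p q' p' g)
  have B: "farey_basis q p q' p'" using left.hyps by (rule stern_brocot_basis)
  have "1 \<le> k"
  proof (rule ccontr)
    assume "\<not> 1 \<le> k"
    then have "k * (q + q') \<le> 0"
      using B by (auto simp: farey_basis_def intro: mult_nonpos_nonneg)
    then show False using left.prems farey_basis_pos[OF B] by linarith
  qed
  then have "stern_brocot (q + q') (p + p') (q' + (k - 1) * (q + q')) (p' + (k - 1) * (p + p'))
      (g - 1 + (k - 1))"
    by (intro stern_brocot_left_iter stern_brocot.right left.hyps) simp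
  then show ?case by (simp add: algebra_simps)
next
  case (right q p q' p' g)
  have "stern_brocot q' p' ((k - 1) * q' - q) ((k - 1) * p' - p) (g + (k - 1) - 3)"
    by (rule right.IH) (use right.prems in \<open>simp_all add: algebra_simps\<close>)
  then show ?case by (simp add: algebra_simps)
qed

text \<open>The last move can be read off from the pair: after a right move the first vector would
  exceed the second in its first coordinate.\<close>

lemma stern_brocot_left_inv:
  assumes "stern_brocot q p (q + q') (p + p') g" "0 \<le> q'" "0 \<le> p'"
  shows "stern_brocot q p q' p' (g - 1)"
  using assms(1)
proof cases
  case base
  then show ?thesis using assms by simp
next
  case left
  then show ?thesis by simp
next
  case (right u u' g')
  then have "0 < u" using farey_basis_pos stern_brocot_basis by blast
  then show ?thesis using right assms(2) by simp
qed

lemma stern_brocot_right_inv: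
  assumes "stern_brocot (q + q') (p + p') q' p' g" "0 \<le> q" "0 \<le> p"
  shows "stern_brocot q p q' p' (g + 1)"
  using assms(1)
proof cases
  case base
  then show ?thesis using assms by simp
next
  case (left w w' g')
  then have "0 < w'" using farey_basis_pos stern_brocot_basis by blast
  then show ?thesis using left assms(3) by simp
next
  case right
  then show ?thesis by simp
qed

lemma stern_brocot_left_iter_inv:
  assumes "0 \<le> k" "stern_brocot q p (q' + k * q) (p' + k * p) g" "0 \<le> q'" "0 \<le> p'"
  shows "stern_brocot q p q' p' (g - k)"
  using assms(1,2)
proof (induction k arbitrary: g rule: int_ge_induct)
  case base
  then show ?case by simp
next
  case (step k)
  have B: "0 \<le> q" "0 \<le> p"
    using stern_brocot_basis[OF step.prems] by (auto simp: farey_basis_def)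
  have "stern_brocot q p (q' + k * q) (p' + k * p) (g - 1)"
    by (rule stern_brocot_left_inv)
      (use step.prems step.hyps B assms in \<open>simp_all add: algebra_simps\<close>)
  from step.IH[OF this] show ?case by (simp add: algebra_simps)
qed

lemma stern_brocot_right_iter_inv:
  assumes "0 \<le> k" "stern_brocot (q + k * q') (p + k * p') q' p' g" "0 \<le> q" "0 \<le> p"
  shows "stern_brocot q p q' p' (g + k)"
  using assms(1,2)
proof (induction k arbitrary: g rule: int_ge_induct)
  case base
  then show ?case by simp
next
  case (step k)
  have B: "0 \<le> q'" "0 \<le> p'"
    using stern_brocot_basis[OF step.prems] by (auto simp: farey_basis_def)
  have "stern_brocot (q + k * q') (p + k * p') q' p' (g + 1)"
    by (rule stern_brocot_right_inv)
      (use step.prems step.hyps B assms in \<open>simp_all add: algebra_simps\<close>)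
  from step.IH[OF this] show ?case by (simp add: algebra_simps)
qed

text \<open>Undoing the moves one by one shows that the counter depends on the pair alone. This
  allows values obtained at different orbit indices to be compared.\<close>

lemma stern_brocot_unique:
  assumes "stern_brocot q p q' p' g" "stern_brocot q p q' p' g'"
  shows "g = g'"
  using assms
proof (induction arbitrary: g' rule: stern_brocot.induct)
  case base
  then show ?case
  proof cases
    case (left w w' g')
    then show ?thesis using stern_brocot_basis[OF left(4)] by (auto simp: farey_basis_def)
  next
    case (right u u' g')
    then show ?thesis using stern_brocot_basis[OF right(4)] by (auto simp: farey_basis_def)
  qed simp
next
  case (left q p q' p' g)
  have "stern_brocot q p q' p' (g' - 1)"
    using left.prems stern_brocot_basis[OF left.hyps]
    by (intro stern_brocot_left_inv) (auto simp: farey_basis_def)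
  from left.IH[OF this] show ?case by simp
next
  case (right q p q' p' g)
  have "stern_brocot q p q' p' (g' + 1)"
    using right.prems stern_brocot_basis[OF right.hyps]
    by (intro stern_brocot_right_inv) (auto simp: farey_basis_def)
  from right.IH[OF this] show ?case by simp
qed

text \<open>The number of maximal runs of equal moves is at most logarithmic, because
  \<open>(q + p) * (q' + p')\<close> at least doubles along every run.\<close>

lemma stern_brocot_run_bound:
  fixes M :: real and P :: "int \<Rightarrow> int \<Rightarrow> int \<Rightarrow> int \<Rightarrow> bool"
  assumes "stern_brocot q p q' p' g" and "P q p q' p'"
    and Pl: "\<And>q p q' p'. farey_basis q p q' p' \<Longrightarrow> P q p (q + q') (p + p') \<Longrightarrow> P q p q' p'"
    and Pr: "\<And>q p q' p'. farey_basis q p q' p' \<Longrightarrow> P (q + q') (p + p') q' p' \<Longrightarrow> P q p q' p'"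
    and Ml: "\<And>q p q' p' j. farey_basis q p q' p' \<Longrightarrow> 1 \<le> j \<Longrightarrow>
      P q p (q' + j * q) (p' + j * p) \<Longrightarrow> of_int j \<le> M"
    and Mr: "\<And>q p q' p' j. farey_basis q p q' p' \<Longrightarrow> 1 \<le> j \<Longrightarrow>
      P (q + j * q') (p + j * p') q' p' \<Longrightarrow> of_int j \<le> M"
    and M0: "0 \<le> M"
  shows "\<bar>of_int g\<bar> \<le> 3 + M + M * log 2 (of_int (q + p) * of_int (q' + p'))"
proof -
  \<comment> \<open>\<open>A\<close> describes a path ending with \<open>j\<close> left moves from
    the pair \<open>(q, p)\<close>, \<open>(u, u')\<close>, and \<open>B\<close> one ending with
    \<open>j\<close> right moves. The current run is counted by \<open>j\<close>, completed runs are
    charged to the logarithm; \<open>j = 0\<close> in \<open>A\<close> serves the empty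
    path.\<close>
  define A where "A q p q' p' (g::int) \<longleftrightarrow> (\<exists>j u u'. 0 \<le> j \<and> farey_basis q p u u' \<and>
      q' = u + j * q \<and> p' = u' + j * p \<and> u + u' \<le> q + p \<and> (j = 0 \<longrightarrow> u + u' = q + p) \<and>
      \<bar>of_int g\<bar> \<le> 3 + of_int j + M * log 2 (of_int (q + p) * of_int (u + u')))"
    for q p q' p' g
  define B where "B q p q' p' (g::int) \<longleftrightarrow> (\<exists>j u u'. 1 \<le> j \<and> farey_basis u u' q' p' \<and>
      q = u + j * q' \<and> p = u' + j * p' \<and> u + u' \<le> q' + p' \<and>
      \<bar>of_int g\<bar> \<le> 3 + of_int j + M * log 2 (of_int (u + u') * of_int (q' + p')))"
    for q p q' p' g
  \<comment> \<open>Closing a run: the argument of the logarithm doubles, and the gain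
    \<open>M \<ge> j\<close> pays for the run.\<close>
  have dbl: "of_int j + M * log 2 (x * of_int u) \<le> M * log 2 (x * of_int w)"
    if "1 \<le> j" "of_int j \<le> M" "0 < x" "0 < u" "u + u \<le> w" for j u w :: int and x :: real
  proof -
    have "log 2 (x * of_int u) + 1 = log 2 (x * of_int u * 2)"
      using that by (subst log_mult) auto
    also have "\<dots> \<le> log 2 (x * of_int w)"
      using that by (subst log_le_cancel_iff) (auto simp: field_simps simp flip: of_int_add)
    finally have "M * (log 2 (x * of_int u) + 1) \<le> M * log 2 (x * of_int w)"
      using M0 by (rule mult_left_mono)
    then show ?thesis using that by (simp add: algebra_simps)
  qed
  have AB: "A q p q' p' g \<or> B q p q' p' g"
    using assms(1,2)
  proof (induction rule: stern_brocot.induct)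
    case base
    have "A 1 0 0 1 (- 3)"
      unfolding A_def by (rule exI[of _ 0]) (auto simp: farey_basis_def)
    then show ?case by simp
  next
    case (left q p q' p' g)
    have bas: "farey_basis q p q' p'" using left.hyps by (rule stern_brocot_basis)
    have P: "P q p q' p'" using Pl[OF bas left.prems] .
    from left.IH[OF P] show ?case
    proof
      assume "A q p q' p' g"
      then obtain j u u' where j: "0 \<le> j" "farey_basis q p u u'" "q' = u + j * q"
        "p' = u' + j * p" "u + u' \<le> q + p"
        "\<bar>of_int g\<bar> \<le> 3 + of_int j + M * log 2 (of_int (q + p) * of_int (u + u'))"
        unfolding A_def by blast
      have "\<bar>of_int (g + 1)\<bar> \<le> 3 + of_int (j + 1) + M * log 2 (of_int (q + p) * of_int (u + u'))"
        using j(6) by auto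
      then have "A q p (q + q') (p + p') (g + 1)"
        unfolding A_def using j(1-5)
        by (intro exI[of _ "j + 1"] exI[of _ u] exI[of _ u']) (auto simp: algebra_simps)
      then show ?thesis by simp
    next
      assume "B q p q' p' g"
      then obtain j u u' where j: "1 \<le> j" "farey_basis u u' q' p'" "q = u + j * q'"
        "p = u' + j * p'" "u + u' \<le> q' + p'"
        "\<bar>of_int g\<bar> \<le> 3 + of_int j + M * log 2 (of_int (u + u') * of_int (q' + p'))"
        unfolding B_def by blast
      have nn: "0 \<le> q'" "0 \<le> p'" "0 < u + u'" "0 < q' + p'"
        using j(2) farey_basis_pos[OF j(2)] by (auto simp: farey_basis_def)
      have jM: "of_int j \<le> M" using Mr[OF j(2) j(1)] P j(3,4) by simp
      have ge: "q' + p' \<le> j * q' + j * p'"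
        using nn j(1) mult_right_mono[of 1 j "q' + p'"] by (simp add: algebra_simps)
      then have "of_int j + M * log 2 (of_int (q' + p') * of_int (u + u'))
          \<le> M * log 2 (of_int (q' + p') * of_int (q + p))"
        using j nn jM by (intro dbl) auto
      then have "\<bar>of_int (g + 1)\<bar> \<le> 3 + of_int 1 + M * log 2 (of_int (q + p) * of_int (q' + p'))"
        using j(6) by (simp add: mult.commute abs_le_iff)
      then have "A q p (q + q') (p + p') (g + 1)"
        unfolding A_def using bas ge j nn
        by (intro exI[of _ 1] exI[of _ q'] exI[of _ p']) (auto simp: algebra_simps)
      then show ?thesis by simp
    qed
  next
    case (right q p q' p' g)
    have bas: "farey_basis q p q' p'" using right.hyps by (rule stern_brocot_basis)
    have P: "P q p q' p'" using Pr[OF bas right.prems] .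
    from right.IH[OF P] show ?case
    proof
      assume "B q p q' p' g"
      then obtain j u u' where j: "1 \<le> j" "farey_basis u u' q' p'" "q = u + j * q'"
        "p = u' + j * p'" "u + u' \<le> q' + p'"
        "\<bar>of_int g\<bar> \<le> 3 + of_int j + M * log 2 (of_int (u + u') * of_int (q' + p'))"
        unfolding B_def by blast
      have "\<bar>of_int (g - 1)\<bar> \<le> 3 + of_int (j + 1) + M * log 2 (of_int (u + u') * of_int (q' + p'))"
        using j(6) by auto
      then have "B (q + q') (p + p') q' p' (g - 1)"
        unfolding B_def using j(1-5)
        by (intro exI[of _ "j + 1"] exI[of _ u] exI[of _ u']) (auto simp: algebra_simps)
      then show ?thesis by simp
    next
      assume "A q p q' p' g"
      then obtain j u u' where j: "0 \<le> j" "farey_basis q p u u'" "q' = u + j * q"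
        "p' = u' + j * p" "u + u' \<le> q + p" "j = 0 \<longrightarrow> u + u' = q + p"
        "\<bar>of_int g\<bar> \<le> 3 + of_int j + M * log 2 (of_int (q + p) * of_int (u + u'))"
        unfolding A_def by blast
      have nn: "0 \<le> q" "0 \<le> p" "0 < u + u'" "0 < q + p"
        using j(2) farey_basis_pos[OF j(2)] by (auto simp: farey_basis_def)
      have *: "q + p \<le> q' + p' \<and> of_int j + M * log 2 (of_int (q + p) * of_int (u + u'))
          \<le> M * log 2 (of_int (q + p) * of_int (q' + p'))"
      proof (cases "j = 0")
        case True
        then show ?thesis using j by simp
      next
        case False
        then have j1: "1 \<le> j" using j by simp
        have jM: "of_int j \<le> M" using Ml[OF j(2) j1] P j(3,4) by simp
        have ge: "q + p \<le> j * q + j * p"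
          using nn j1 mult_right_mono[of 1 j "q + p"] by (simp add: algebra_simps)
        have "of_int j + M * log 2 (of_int (q + p) * of_int (u + u'))
            \<le> M * log 2 (of_int (q + p) * of_int (q' + p'))"
          using j nn jM j1 ge by (intro dbl) auto
        moreover have "q + p \<le> q' + p'" using ge j nn by simp
        ultimately show ?thesis by simp
      qed
      then have "\<bar>of_int (g - 1)\<bar> \<le> 3 + of_int 1 + M * log 2 (of_int (q + p) * of_int (q' + p'))"
        using j(7) by (simp add: abs_le_iff)
      then have "B (q + q') (p + p') q' p' (g - 1)"
        unfolding B_def using bas *
        by (intro exI[of _ 1] exI[of _ q] exI[of _ p]) (auto simp: algebra_simps)
      then show ?thesis by simp
    qed
  qed
  have fin: "\<bar>of_int g\<bar> \<le> 3 + M + M * log 2 (x * of_int w)"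
    if "\<bar>of_int g\<bar> \<le> 3 + of_int j + M * log 2 (x * of_int u)" "of_int j \<le> M" "0 < x"
      "0 < u" "u \<le> w" for j u w :: int and x :: real
  proof -
    have "log 2 (x * of_int u) \<le> log 2 (x * of_int w)"
      using that by (subst log_le_cancel_iff) auto
    then have "M * log 2 (x * of_int u) \<le> M * log 2 (x * of_int w)"
      using M0 by (rule mult_left_mono)
    then show ?thesis using that by linarith
  qed
  from AB show ?thesis
  proof
    assume "A q p q' p' g"
    then obtain j u u' where j: "0 \<le> j" "farey_basis q p u u'" "q' = u + j * q"
      "p' = u' + j * p" "\<bar>of_int g\<bar> \<le> 3 + of_int j + M * log 2 (of_int (q + p) * of_int (u + u'))"
      unfolding A_def by blast
    have nn: "0 \<le> q" "0 \<le> p" "0 < u + u'" "0 < q + p"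
      using j(2) farey_basis_pos[OF j(2)] by (auto simp: farey_basis_def)
    have "of_int j \<le> M"
    proof (cases "j = 0")
      case True
      then show ?thesis using M0 by simp
    next
      case False
      then show ?thesis using Ml[OF j(2), of j] assms(2) j by simp
    qed
    then show ?thesis using j nn by (intro fin[OF j(5)]) auto
  next
    assume "B q p q' p' g"
    then obtain j u u' where j: "1 \<le> j" "farey_basis u u' q' p'" "q = u + j * q'"
      "p = u' + j * p'"
      "\<bar>of_int g\<bar> \<le> 3 + of_int j + M * log 2 (of_int (u + u') * of_int (q' + p'))"
      unfolding B_def by blast
    have nn: "0 \<le> q'" "0 \<le> p'" "0 < u + u'" "0 < q' + p'"
      using j(2) farey_basis_pos[OF j(2)] by (auto simp: farey_basis_def)
    have "of_int j \<le> M" using Mr[OF j(2) j(1)] assms(2) j by simp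
    then have "\<bar>of_int g\<bar> \<le> 3 + M + M * log 2 (of_int (q' + p') * of_int (q + p))"
      using j nn by (intro fin[where u = "u + u'" and j = j]) (auto simp: mult.commute)
    then show ?thesis by (simp add: mult.commute)
  qed
qed

section \<open>The BCZ orbit as a sequence of lattice vectors\<close>

text \<open>The floor selects the multiple of \<open>y\<close> for which the new coordinate lies
  above \<open>1 - y\<close> and not above 1.\<close>

lemma bcz_map_in_triangle:
  assumes "z \<in> farey_triangle"
  shows "bcz_map z \<in> farey_triangle"
proof -
  obtain x y where z: "z = (x, y)" by (cases z)
  have xy: "0 < x" "x \<le> 1" "0 < y" "y \<le> 1" "1 < x + y"
    using assms by (auto simp: z farey_triangle_def)
  define k where "k = \<lfloor>(1 + x) / y\<rfloor>"
  have "of_int k \<le> (1 + x) / y" "(1 + x) / y < of_int k + 1"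
    unfolding k_def by linarith+
  then have "of_int k * y \<le> 1 + x" "1 + x < (of_int k + 1) * y"
    using xy by (simp_all add: field_simps)
  then show ?thesis
    using xy by (auto simp: z farey_triangle_def bcz_map_def bcz_k_def algebra_simps simp flip: k_def)
qed

locale bcz_orbit =
  fixes a b :: real
  assumes in_triangle: "(a, b) \<in> farey_triangle" and irrational: "b / a \<notin> \<rat>"
begin

definition x :: "nat \<Rightarrow> real" where
  "x n = fst ((bcz_map ^^ n) (a, b))"

text \<open>\<open>K n\<close> is \<open>k\<^bsub>n+1\<^esub>\<close> in the statement.\<close>

definition K :: "nat \<Rightarrow> int" where
  "K n = bcz_k ((bcz_map ^^ n) (a, b))"

definition f :: "nat \<Rightarrow> int" where
  "f n = (\<Sum>i<n. K i - 3)"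

fun q :: "nat \<Rightarrow> int" where
  "q 0 = 0"
| "q (Suc 0) = 1"
| "q (Suc (Suc n)) = K n * q (Suc n) - q n"

fun p :: "nat \<Rightarrow> int" where
  "p 0 = - 1"
| "p (Suc 0) = 0"
| "p (Suc (Suc n)) = K n * p (Suc n) - p n"

text \<open>The determinant of \<open>(u, v)\<close> and \<open>(a, b)\<close>: for
  \<open>u > 0\<close> it is positive exactly when \<open>v / u\<close> approximates
  \<open>b / a\<close> from below.\<close>

definition ht :: "int \<Rightarrow> int \<Rightarrow> real" where
  "ht u v = of_int u * b - of_int v * a"

definition X :: "nat \<Rightarrow> real" where
  "X n = of_int (q n) / x n"

lemma ab: "0 < a" "a \<le> 1" "0 < b" "b \<le> 1" "1 < a + b"
  using in_triangle by (auto simp: farey_triangle_def)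

lemma orbit_in_triangle: "(bcz_map ^^ n) (a, b) \<in> farey_triangle"
  by (induction n) (auto simp: in_triangle bcz_map_in_triangle)

lemma orbit_eq: "(bcz_map ^^ n) (a, b) = (x n, x (Suc n))"
  by (cases "(bcz_map ^^ n) (a, b)") (simp add: x_def bcz_map_def)

lemma x_0 [simp]: "x 0 = a" and x_1 [simp]: "x (Suc 0) = b"
  by (simp_all add: x_def bcz_map_def)

lemma x_Suc_Suc: "x (Suc (Suc n)) = of_int (K n) * x (Suc n) - x n"
proof -
  have "x (Suc (Suc n)) = snd ((bcz_map ^^ (Suc n)) (a, b))"
    by (simp only: orbit_eq snd_conv)
  also have "\<dots> = snd (bcz_map (x n, x (Suc n)))"
    by (simp add: orbit_eq)
  finally show ?thesis unfolding K_def orbit_eq by (simp add: bcz_map_def)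
qed

lemma x_pos: "0 < x n" and x_le_1: "x n \<le> 1" and x_add_Suc: "1 < x n + x (Suc n)"
  using orbit_in_triangle[of n] unfolding orbit_eq by (auto simp: farey_triangle_def)

lemma ht_add: "ht (u + u') (v + v') = ht u v + ht u' v'"
  by (simp add: ht_def algebra_simps)

lemma ht_mult: "ht (k * u) (k * v) = of_int k * ht u v"
  by (simp add: ht_def algebra_simps)

lemma ht_diff: "ht (u - u') (v - v') = ht u v - ht u' v'"
  by (simp add: ht_def algebra_simps)

lemma ht_cross: "of_int u' * ht u v - of_int u * ht u' v' = a * of_int (u * v' - u' * v)"
  by (simp add: ht_def algebra_simps)

lemma ht_nonzero:
  assumes "u \<noteq> 0"
  shows "ht u v \<noteq> 0"
proof
  assume "ht u v = 0"
  then have "b / a = of_int v / of_int u"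
    using ab assms by (simp add: ht_def field_simps)
  then show False using irrational by simp
qed

lemma x_eq_ht: "x n = ht (q n) (p n)"
proof (induction n rule: q.induct)
  case (3 n)
  then show ?case by (simp only: q.simps p.simps ht_diff ht_mult x_Suc_Suc)
qed (simp_all add: ht_def)

lemma det: "q n * p (Suc n) - q (Suc n) * p n = 1"
  by (induction n) (auto simp: algebra_simps)

lemma X_0 [simp]: "X 0 = 0"
  by (simp add: X_def)

lemma X_Suc: "X (Suc n) = X n + a / (x n * x (Suc n))"
proof -
  have "of_int (q (Suc n)) * x n - of_int (q n) * x (Suc n) = a"
    unfolding x_eq_ht ht_cross det by simp
  then show ?thesis
    using x_pos[of n] x_pos[of "Suc n"] by (simp add: X_def field_simps)
qed

lemma X_Suc_ge: "X n + a \<le> X (Suc n)"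
proof -
  have "x n * x (Suc n) \<le> 1"
    using x_pos[of n] x_pos[of "Suc n"] x_le_1[of n] x_le_1[of "Suc n"]
    by (simp add: mult_le_one)
  then have "a \<le> a / (x n * x (Suc n))"
    using ab x_pos[of n] x_pos[of "Suc n"] by (simp add: field_simps)
  then show ?thesis by (simp add: X_Suc)
qed

lemma X_ge: "a * real n \<le> X n"
proof (induction n)
  case (Suc n)
  then show ?case using X_Suc_ge[of n] by (simp add: algebra_simps)
qed simp

lemma X_nonneg: "0 \<le> X n"
  by (rule order_trans[OF _ X_ge]) (use ab in simp)

lemma X_strict_mono: "strict_mono X"
  unfolding strict_mono_Suc_iff using X_Suc_ge ab by (smt (verit))

lemma q_pos: "0 < n \<Longrightarrow> 0 < q n"
proof -
  assume "0 < n"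
  then have "0 < a * real n" using ab by simp
  then have "0 < X n" using X_ge[of n] by linarith
  then have "0 < real_of_int (q n)" using x_pos[of n] by (simp add: X_def zero_less_divide_iff)
  then show ?thesis by simp
qed

lemma q_nonneg: "0 \<le> q n"
  using q_pos[of n] by (cases "n = 0") auto

lemma p_nonneg: "0 < n \<Longrightarrow> 0 \<le> p n"
proof (induction n)
  case (Suc n)
  show ?case
  proof (cases "n = 0")
    case False
    then have "0 \<le> p n" "0 < q n" "0 < q (Suc n)" using Suc q_pos by auto
    then have "0 < q n * p (Suc n)" using det[of n]
      by (smt (verit) mult_nonneg_nonneg)
    then show ?thesis using \<open>0 < q n\<close> by (simp add: zero_less_mult_iff)
  qed simp
qed simp

lemma f_0 [simp]: "f 0 = 0" and f_Suc: "f (Suc n) = f n + (K n - 3)"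
  by (simp_all add: f_def)

lemma bcz_sum_eq: "bcz_sum (a, b) n = f n"
proof -
  have "bcz_sum (a, b) n = (\<Sum>i = Suc 0..n. K (i - 1) - 3)"
    by (simp add: bcz_sum_def bcz_itinerary_def K_def)
  also have "\<dots> = f n"
    unfolding f_def by (rule sum.reindex_bij_witness[of _ Suc "\<lambda>i. i - 1"]) auto
  finally show ?thesis .
qed

lemma stern_brocot_orbit:
  "stern_brocot (q (Suc n)) (p (Suc n)) (q (Suc (Suc n))) (p (Suc (Suc n))) (f (Suc n))"
proof (induction n)
  case 0
  \<comment> \<open>The second vector of the first orbit pair is \<open>(K 0, 1)\<close>, reached
    from the root by \<open>K 0\<close> left moves.\<close>
  have "0 \<le> K 0" using q_nonneg[of 2] by (simp add: numeral_2_eq_2)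
  then show ?case
    using stern_brocot_left_iter[OF stern_brocot.base, of "K 0"] by (simp add: f_Suc)
next
  case (Suc n)
  have "0 \<le> K (Suc n) * q (Suc (Suc n)) - q (Suc n)" "0 \<le> K (Suc n) * p (Suc (Suc n)) - p (Suc n)"
    using q_nonneg[of "Suc (Suc (Suc n))"] p_nonneg[of "Suc (Suc (Suc n))"] by simp_all
  from stern_brocot_step[OF Suc this] show ?case by (simp add: f_Suc algebra_simps)
qed

lemma stern_brocot_f:
  "0 < n \<Longrightarrow> stern_brocot (q n) (p n) (q (Suc n)) (p (Suc n)) (f n)"
  using stern_brocot_orbit[of "n - 1"] by simp

text \<open>A lattice vector in the open cone of two neighbours has height at least
  \<open>x n + x (Suc n) > 1\<close>.\<close>

lemma orbit_complete:
  assumes "1 \<le> u" "coprime u v" "0 < ht u v" "ht u v \<le> 1"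
  obtains n where "0 < n" "q n = u" "p n = v"
proof -
  define Y where "Y = of_int u / ht u v"
  have Y: "0 < Y" using assms by (simp add: Y_def)
  obtain N where "Y / a < real N" using reals_Archimedean2 by blast
  then have "Y < a * real N" using ab by (simp add: field_simps)
  then have exN: "Y < X N" using X_ge[of N] by linarith
  \<comment> \<open>\<open>Y\<close> plays the role of \<open>X\<close> for the vector
    \<open>(u, v)\<close>. The first index with \<open>X\<close> beyond \<open>Y\<close> locates the
    vector in the cone of two consecutive orbit vectors; \<alpha> and \<beta> are its coordinates
    there by Cramer's rule.\<close>
  define m where "m = (LEAST m. Y < X m)"
  have m: "Y < X m" unfolding m_def using exN by (rule LeastI)
  have "m \<noteq> 0" using m Y by (cases m) auto
  then obtain n where n: "m = Suc n" using not0_implies_Suc by blast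
  have Xn: "X n \<le> Y" using not_less_Least[of n "\<lambda>m. Y < X m"] n by (simp add: m_def)
  define \<alpha> where "\<alpha> = u * p (Suc n) - q (Suc n) * v"
  define \<beta> where "\<beta> = q n * v - u * p n"
  have "a * of_int \<alpha> = of_int (q (Suc n)) * ht u v - of_int u * x (Suc n)"
    unfolding \<alpha>_def x_eq_ht ht_cross ..
  also have "\<dots> > 0"
    using m assms x_pos[of "Suc n"] by (simp add: n X_def Y_def field_simps)
  finally have \<alpha>: "1 \<le> \<alpha>" using ab by (simp add: zero_less_mult_iff)
  have "a * of_int \<beta> = of_int u * x n - of_int (q n) * ht u v"
    unfolding \<beta>_def x_eq_ht ht_cross ..
  also have "\<dots> \<ge> 0"
    using Xn assms x_pos[of n] by (simp add: X_def Y_def field_simps)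
  finally have \<beta>: "0 \<le> \<beta>" using ab by (simp add: zero_le_mult_iff)
  have "u * (q n * p (Suc n) - q (Suc n) * p n) = \<alpha> * q n + \<beta> * q (Suc n)"
    by (simp add: \<alpha>_def \<beta>_def algebra_simps)
  then have u: "u = \<alpha> * q n + \<beta> * q (Suc n)" unfolding det by simp
  have "v * (q n * p (Suc n) - q (Suc n) * p n) = \<alpha> * p n + \<beta> * p (Suc n)"
    by (simp add: \<alpha>_def \<beta>_def algebra_simps)
  then have v: "v = \<alpha> * p n + \<beta> * p (Suc n)" unfolding det by simp
  have h: "ht u v = of_int \<alpha> * x n + of_int \<beta> * x (Suc n)"
    by (subst u, subst v) (simp only: ht_add ht_mult x_eq_ht)
  have "\<beta> = 0"
  proof (rule ccontr)
    assume "\<beta> \<noteq> 0"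
    then have "1 \<le> \<beta>" using \<beta> by simp
    then have "1 * x n + 1 * x (Suc n) \<le> of_int \<alpha> * x n + of_int \<beta> * x (Suc n)"
      using \<alpha> x_pos[of n] x_pos[of "Suc n"] by (intro add_mono mult_right_mono) auto
    then show False using h assms x_add_Suc[of n] by simp
  qed
  then have uv: "u = \<alpha> * q n" "v = \<alpha> * p n" using u v by auto
  then have "\<alpha> dvd 1" using assms(2) by (metis coprime_common_divisor dvd_triv_left)
  then have "\<alpha> = 1" using \<alpha> by simp
  then have "u = q n" "v = p n" using uv by auto
  moreover have "0 < n" using \<open>u = q n\<close> assms(1) by (cases n) auto
  ultimately show ?thesis using that by simp
qed

lemma K_floor: "of_int (K n) \<le> (1 + x n) / x (Suc n)" "(1 + x n) / x (Suc n) < of_int (K n) + 1"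
  by (simp_all add: K_def orbit_eq bcz_k_def)

text \<open>\<open>K n = K (n + 1) = 3\<close> would give \<open>2 (x (n + 1) + x (n + 2)) = x n + x (n + 3) \<le> 2\<close>.\<close>

lemma not_both_3: "\<not> (K n = 3 \<and> K (Suc n) = 3)"
  using x_Suc_Suc[of n] x_Suc_Suc[of "Suc n"] x_add_Suc[of "Suc n"] x_le_1[of n]
    x_le_1[of "Suc (Suc (Suc n))"] by auto

text \<open>Three consecutive zeros of \<open>f\<close> would make two consecutive entries equal to
  3. Since \<open>log 0\<close> counts as \<open>- \<infinity>\<close>, this is what keeps the
  limsup from being negative.\<close>

lemma f_nonzero_frequently: "\<exists>n\<ge>N. f n \<noteq> 0"
proof (rule ccontr)
  assume "\<not> ?thesis"
  then have "f N = 0" "f (Suc N) = 0" "f (Suc (Suc N)) = 0" by auto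
  then show False using not_both_3[of N] by (simp add: f_Suc)
qed

end

section \<open>Linear growth of \<open>X n\<close> in \<open>n\<close>\<close>

text \<open>A small entry \<open>y\<close> is followed by about \<open>1 / (2 y)\<close> entries above \<open>1/2\<close>, an arithmetic
  progression with difference \<open>- y\<close>. The debt is what remains to be paid, in terms of
  these large entries, for the last small entry.\<close>

definition bcz_debt :: "real \<Rightarrow> real \<Rightarrow> real" where
  "bcz_debt x y = (if y \<le> 1/2 then 1 / y else if x \<le> 1/2 then 1 / x
     else if y < x then 2 * (y - 1/2) / (x - y) else 0)"

lemma bcz_debt_nonneg: "0 < x \<Longrightarrow> 0 < y \<Longrightarrow> 0 \<le> bcz_debt x y"
  by (auto simp: bcz_debt_def)

text \<open>Amortised cost of \<open>1 / z\<close>, to be telescoped over the orbit. A small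
  \<open>z\<close> is paid by the new debt \<open>1 / z\<close>, as the old debt is then at most 6;
  for a large \<open>z\<close> the cost is at most 2 and the debt drops by at most 4.\<close>

lemma bcz_debt_step:
  fixes k :: int
  assumes xy: "0 < x" "x \<le> 1" "0 < y" "y \<le> 1" "1 < x + y"
    and z: "z = of_int k * y - x" "0 < z" "z \<le> 1" "1 < y + z"
  shows "bcz_debt x y + 1 / z \<le> 6 + bcz_debt y z"
proof -
  have "1 \<le> k"
  proof (rule ccontr)
    assume "\<not> 1 \<le> k"
    then have "of_int k * y \<le> 0" using xy by (intro mult_nonpos_nonneg) auto
    then show False using z xy by linarith
  qed
  then consider "k = 1" | "k = 2" | "3 \<le> k" by linarith
  then have k: "z = y - x \<or> z = 2 * y - x \<or> 3 * y - x \<le> z"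
  proof cases
    case 3
    then have "3 * y \<le> of_int k * y" using xy by (intro mult_right_mono) auto
    then show ?thesis using z by simp
  qed (use z in auto)
  consider "y \<le> 1/2" | "1/2 < y" "z \<le> 1/2" | "1/2 < y" "1/2 < z" by linarith
  then show ?thesis
  proof cases
    case 1
    then have "1/2 < z" using z by linarith
    then have "1 / z \<le> 2" by (simp add: field_simps)
    then show ?thesis using 1 \<open>1/2 < z\<close> by (simp add: bcz_debt_def)
  next
    case 2
    have "bcz_debt x y \<le> 6"
    proof (cases "x \<le> 1/2")
      case True
      then have "1/4 \<le> x" using k 2 xy z by linarith
      then have "1 / x \<le> 4" using xy by (simp add: field_simps)
      then show ?thesis using True 2 by (simp add: bcz_debt_def)
    next
      case False
      have "2 * (y - 1/2) / (x - y) \<le> 2" if "y < x"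
      proof -
        have "y - 1/2 \<le> x - y" using k 2 xy z that by linarith
        then show ?thesis using that by (simp add: field_simps)
      qed
      then show ?thesis using False 2 by (auto simp: bcz_debt_def)
    qed
    then show ?thesis using 2 by (simp add: bcz_debt_def)
  next
    case 3
    have z2: "1 / z \<le> 2" using 3 by (simp add: field_simps)
    have D0: "0 \<le> bcz_debt y z" using xy z by (simp add: bcz_debt_nonneg)
    have "bcz_debt x y \<le> 4 + bcz_debt y z"
    proof (cases "x \<le> 1/2")
      case True
      show ?thesis
      proof (cases "z = y - x")
        case True
        \<comment> \<open>\<open>x + y > 1\<close> gives \<open>z > 1 - 2 * x\<close>, so switching
          from \<open>1 / x\<close> to the progression formula lowers the debt by at most 4.\<close>
        have "1 / x - 4 = 2 * (1 - 2 * x - 1/2) / x" using xy by (simp add: field_simps)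
        also have "\<dots> \<le> 2 * (z - 1/2) / x"
          using xy True by (intro divide_right_mono) auto
        also have "\<dots> = bcz_debt y z" using 3 True xy by (simp add: bcz_debt_def)
        finally show ?thesis using \<open>x \<le> 1/2\<close> 3 by (simp add: bcz_debt_def)
      next
        case False
        then have "1/4 \<le> x" using k 3 xy z by linarith
        then have "1 / x \<le> 4" using xy by (simp add: field_simps)
        then show ?thesis using True 3 D0 by (simp add: bcz_debt_def)
      qed
    next
      case x: False
      show ?thesis
      proof (cases "y < x")
        case True
        show ?thesis
        proof (cases "z = 2 * y - x")
          case z': True
          \<comment> \<open>Inside a progression the difference is constant and each entry lowers
            the debt by exactly 2.\<close>
          have "2 * (y - 1/2) / (x - y) = 2 + 2 * (z - 1/2) / (x - y)"
            using True by (simp add: z' field_simps)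
          also have "2 * (z - 1/2) / (x - y) = bcz_debt y z"
            using 3 True by (simp add: bcz_debt_def z')
          finally show ?thesis using x 3 True by (simp add: bcz_debt_def)
        next
          case False
          then have "y - 1/2 \<le> x - y" using k 3 xy z True by linarith
          then have "2 * (y - 1/2) / (x - y) \<le> 2" using True by (simp add: field_simps)
          then show ?thesis using x 3 True D0 by (simp add: bcz_debt_def)
        qed
      next
        case False
        then show ?thesis using x 3 D0 by (simp add: bcz_debt_def)
      qed
    qed
    then show ?thesis using z2 by linarith
  qed
qed

context bcz_orbit
begin

text \<open>For each of finitely many \<open>u\<close> the least positive height is attained at the
  largest \<open>v\<close> below \<open>u * b / a\<close>.\<close>

lemma ht_lower_bound:
  obtains \<delta> where "0 < \<delta>" "\<And>u v. \<bar>u\<bar> \<le> N \<Longrightarrow> 0 < ht u v \<Longrightarrow> \<delta> \<le> ht u v"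
proof -
  define d where "d u = ht u (\<lceil>of_int u * b / a\<rceil> - 1)" for u
  have dpos: "0 < d u" for u
  proof -
    have "of_int (\<lceil>of_int u * b / a\<rceil> - 1) < of_int u * b / a" by linarith
    then show ?thesis using ab by (simp add: d_def ht_def field_simps)
  qed
  have dle: "d u \<le> ht u v" if "0 < ht u v" for u v
  proof -
    have "of_int v < of_int u * b / a" using that ab by (simp add: ht_def field_simps)
    then have "v \<le> \<lceil>of_int u * b / a\<rceil> - 1" by (simp add: less_ceiling_iff)
    then have "of_int v * a \<le> of_int (\<lceil>of_int u * b / a\<rceil> - 1) * a"
      using ab by (intro mult_right_mono) (auto simp only: of_int_le_iff)
    then show ?thesis by (simp add: d_def ht_def)
  qed
  define \<delta> where "\<delta> = Min (insert 1 (d ` {- N..N}))"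
  have "0 < \<delta>" unfolding \<delta>_def using dpos by (subst Min_gr_iff) auto
  moreover have "\<delta> \<le> ht u v" if "\<bar>u\<bar> \<le> N" "0 < ht u v" for u v
  proof -
    have "d u \<in> d ` {- N..N}" using that(1) by (intro imageI) auto
    then have "\<delta> \<le> d u" unfolding \<delta>_def by (intro Min_le) auto
    then show ?thesis using dle[OF that(2)] by simp
  qed
  ultimately show ?thesis using that by blast
qed

text \<open>A nonzero debt is at most \<open>1 / h\<close>, where \<open>h\<close> is the height of
  \<open>v (n + 1)\<close>, \<open>v n\<close> or their difference, and the first coordinate
  \<open>u\<close> of that vector satisfies \<open>u \<le> X (n + 1) * h\<close>. For
  \<open>u > 4\<close> this gives a quarter of \<open>X\<close>; the other \<open>u\<close> are
  finitely many and give the constant.\<close>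

lemma debt_bound:
  obtains D where "\<And>n. bcz_debt (x n) (x (Suc n)) \<le> X (Suc n) / 4 + D"
proof -
  obtain \<delta> where \<delta>: "0 < \<delta>" "\<And>u v. \<bar>u\<bar> \<le> 4 \<Longrightarrow> 0 < ht u v \<Longrightarrow> \<delta> \<le> ht u v"
    using ht_lower_bound[of 4] by blast
  have inv: "1 / ht u v \<le> X (Suc n) / 4 + 1 / \<delta>"
    if "0 < ht u v" "- 4 \<le> u" "of_int u \<le> X (Suc n) * ht u v" for u v n
  proof (cases "u \<le> 4")
    case True
    then have "\<delta> \<le> ht u v" using that by (intro \<delta>) auto
    then have "1 / ht u v \<le> 1 / \<delta>" using \<delta> that by (simp add: frac_le)
    moreover have "0 \<le> X (Suc n)"
      by (rule X_nonneg)
    ultimately show ?thesis by simp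
  next
    case False
    then have "4 \<le> X (Suc n) * ht u v" using that(3) by linarith
    then have "1 / ht u v \<le> X (Suc n) / 4" using that(1) by (simp add: field_simps)
    then show ?thesis using \<delta>(1) by (simp add: add_increasing2)
  qed
  have "bcz_debt (x n) (x (Suc n)) \<le> X (Suc n) / 4 + 1 / \<delta>" for n
  proof -
    note xp = x_pos[of n] x_pos[of "Suc n"]
    have qn: "of_int (q n) \<le> X (Suc n) * x n"
    proof -
      have "of_int (q n) = X n * x n" using xp by (simp add: X_def)
      also have "\<dots> \<le> X (Suc n) * x n"
        using X_strict_mono xp by (intro mult_right_mono) (auto simp: strict_mono_less_eq)
      finally show ?thesis .
    qed
    have qS: "of_int (q (Suc n)) = X (Suc n) * x (Suc n)" using xp by (simp add: X_def)
    consider "x (Suc n) \<le> 1/2" | "1/2 < x (Suc n)" "x n \<le> 1/2"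
      | "1/2 < x (Suc n)" "1/2 < x n" "x (Suc n) < x n"
      | "1/2 < x (Suc n)" "1/2 < x n" "x n \<le> x (Suc n)" by linarith
    then show ?thesis
    proof cases
      case 1
      then show ?thesis
        using inv[of "q (Suc n)" "p (Suc n)" n] q_nonneg[of "Suc n"] xp qS
        by (simp add: bcz_debt_def flip: x_eq_ht)
    next
      case 2
      then show ?thesis
        using inv[of "q n" "p n" n] q_nonneg[of n] xp qn
        by (simp add: bcz_debt_def flip: x_eq_ht)
    next
      case 3
      define u where "u = q n - q (Suc n)"
      define v where "v = p n - p (Suc n)"
      have h: "ht u v = x n - x (Suc n)" by (simp add: u_def v_def ht_diff flip: x_eq_ht)
      have "of_int (q (Suc n)) * x n - of_int (q n) * x (Suc n) = a"
        unfolding x_eq_ht ht_cross det by simp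
      then have e: "of_int u * x n = of_int (q n) * ht u v - a"
        unfolding h by (simp add: u_def algebra_simps)
      have "0 \<le> of_int (q n) * ht u v" using 3 h q_nonneg by simp
      then have "- 1 \<le> of_int u * x n" using e ab by linarith
      \<comment> \<open>The difference vector may have a negative first coordinate;
        \<open>x n > 1/2\<close> bounds it below, so that \<open>inv\<close> applies.\<close>
      have "- 4 \<le> u"
      proof (rule ccontr)
        assume "\<not> - 4 \<le> u"
        then have "of_int u * x n \<le> - 4 * x n" using xp by (intro mult_right_mono) auto
        then show False using \<open>- 1 \<le> of_int u * x n\<close> 3 by linarith
      qed
      moreover have "of_int u \<le> X (Suc n) * ht u v"
      proof -
        have "of_int u * x n \<le> of_int (q n) * ht u v" using e ab by linarith
        also have "\<dots> \<le> X (Suc n) * x n * ht u v"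
          using qn 3 h by (intro mult_right_mono) auto
        finally have "of_int u * x n \<le> (X (Suc n) * ht u v) * x n" by (simp add: ac_simps)
        then show ?thesis using xp by simp
      qed
      ultimately have "1 / ht u v \<le> X (Suc n) / 4 + 1 / \<delta>"
        using 3 h by (intro inv) auto
      moreover have "bcz_debt (x n) (x (Suc n)) \<le> 1 / ht u v"
        using 3 x_le_1[of "Suc n"] by (simp add: bcz_debt_def h divide_right_mono)
      ultimately show ?thesis by linarith
    next
      case 4
      have "0 \<le> X (Suc n)"
        by (rule X_nonneg)
      then show ?thesis using 4 \<delta> by (simp add: bcz_debt_def)
    qed
  qed
  then show ?thesis using that by blast
qed

text \<open>Since \<open>x n + x (n + 1) > 1\<close>, an increment of \<open>X\<close> is at most
  \<open>a / x n + a / x (n + 1)\<close>, so \<open>X\<close> is at most twice the sum of the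
  reciprocals. The debt bounds that sum by \<open>O(n)\<close> plus a quarter of \<open>X\<close>,
  and the resulting half of \<open>X\<close> is absorbed on the left.\<close>

lemma X_linear_bound:
  obtains C where "0 < C" "\<And>n. X (Suc n) \<le> C * real (Suc n)"
proof -
  obtain D where D: "\<And>n. bcz_debt (x n) (x (Suc n)) \<le> X (Suc n) / 4 + D"
    using debt_bound by blast
  have S: "(\<Sum>i\<le>Suc n. 1 / x i) \<le> 6 * real n + (1 / a + 1 / b) + bcz_debt (x n) (x (Suc n))" for n
  proof (induction n)
    case 0
    then show ?case using bcz_debt_nonneg ab by simp
  next
    case (Suc n)
    have "bcz_debt (x n) (x (Suc n)) + 1 / x (Suc (Suc n))
        \<le> 6 + bcz_debt (x (Suc n)) (x (Suc (Suc n)))"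
      by (rule bcz_debt_step[OF x_pos x_le_1 x_pos x_le_1 x_add_Suc x_Suc_Suc x_pos x_le_1 x_add_Suc])
    then show ?case using Suc by simp
  qed
  have XS: "X n \<le> 2 * a * (\<Sum>i\<le>n. 1 / x i) - a / x n" for n
  proof (induction n)
    case 0
    then show ?case using ab by simp
  next
    case (Suc n)
    have "a / (x n * x (Suc n)) \<le> a * (x n + x (Suc n)) / (x n * x (Suc n))"
      using x_pos[of n] x_pos[of "Suc n"] x_add_Suc[of n] ab by (intro divide_right_mono) auto
    also have "\<dots> = a / x n + a / x (Suc n)"
      using x_pos[of n] x_pos[of "Suc n"] by (simp add: field_simps)
    finally show ?case using Suc by (simp add: X_Suc algebra_simps)
  qed
  define E where "E = \<bar>1 / a + 1 / b + D\<bar>"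
  have "X (Suc n) \<le> (24 + 4 * E) * real (Suc n)" for n
  proof -
    have "0 \<le> (\<Sum>i\<le>Suc n. 1 / x i)" using x_pos by (intro sum_nonneg) (simp add: less_imp_le)
    then have "a * (\<Sum>i\<le>Suc n. 1 / x i) \<le> 1 * (\<Sum>i\<le>Suc n. 1 / x i)"
      using ab by (intro mult_right_mono) auto
    moreover have "0 \<le> a / x (Suc n)" using ab x_pos[of "Suc n"] by simp
    ultimately have "X (Suc n) \<le> 2 * (\<Sum>i\<le>Suc n. 1 / x i)" using XS[of "Suc n"] by linarith
    also have "(\<Sum>i\<le>Suc n. 1 / x i) \<le> 6 * real n + E + X (Suc n) / 4"
    proof -
      have "1 / a + 1 / b + D \<le> E" by (simp add: E_def)
      then have "6 * real n + (1 / a + 1 / b) + bcz_debt (x n) (x (Suc n)) \<le> 6 * real n + E + X (Suc n) / 4"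
        using D[of n] by linarith
      with S[of n] show ?thesis by (rule order_trans)
    qed
    finally have "X (Suc n) \<le> 24 * real n + 4 * E" by simp
    also have "\<dots> \<le> 24 * real (Suc n) + 4 * E * real (Suc n)"
      by (intro add_mono) (auto simp: E_def algebra_simps)
    finally show ?thesis by (simp add: algebra_simps)
  qed
  moreover have "0 < 24 + 4 * E" by (simp add: E_def add_pos_nonneg)
  ultimately show ?thesis using that by blast
qed

end

section \<open>Lengths of runs and the upper bound for \<open>f\<close>\<close>

lemma farey_basis_coprime:
  assumes "farey_basis u v u' v'"
  shows "coprime u v" "coprime u' v'"
proof -
  have e: "u * v' - u' * v = 1" using assms by (simp add: farey_basis_def)
  have "c dvd 1" if "c dvd u" "c dvd v" for c
    unfolding e[symmetric] using that by (intro dvd_diff dvd_mult2 dvd_mult)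
  then show "coprime u v" by (auto intro: coprimeI)
  have "c dvd 1" if "c dvd u'" "c dvd v'" for c
    unfolding e[symmetric] using that by (intro dvd_diff dvd_mult2 dvd_mult)
  then show "coprime u' v'" by (auto intro: coprimeI)
qed

context bcz_orbit
begin

text \<open>The property that is carried along the path: it passes from a pair to its parent, so it
  holds at every pair on the way to the Farey interval of index \<open>n\<close>.\<close>

definition orbit_in_cone :: "nat \<Rightarrow> int \<Rightarrow> int \<Rightarrow> int \<Rightarrow> int \<Rightarrow> bool" where
  "orbit_in_cone n u v u' v' \<longleftrightarrow> (\<exists>\<alpha> \<beta> \<gamma> \<delta>. 0 \<le> \<alpha> \<and> 0 \<le> \<beta> \<and> 0 \<le> \<gamma> \<and> 0 \<le> \<delta> \<and>
     q n = \<alpha> * u + \<beta> * u' \<and> p n = \<alpha> * v + \<beta> * v' \<and>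
     q (Suc n) = \<gamma> * u + \<delta> * u' \<and> p (Suc n) = \<gamma> * v + \<delta> * v')"

lemma orbit_in_cone_self: "orbit_in_cone n (q n) (p n) (q (Suc n)) (p (Suc n))"
  unfolding orbit_in_cone_def
  by (rule exI[of _ 1], rule exI[of _ 0], rule exI[of _ 0], rule exI[of _ 1]) simp

lemma orbit_in_cone_left:
  assumes "orbit_in_cone n u v (u + u') (v + v')"
  shows "orbit_in_cone n u v u' v'"
proof -
  obtain \<alpha> \<beta> \<gamma> \<delta> where *: "0 \<le> \<alpha>" "0 \<le> \<beta>" "0 \<le> \<gamma>" "0 \<le> \<delta>"
    "q n = \<alpha> * u + \<beta> * (u + u')" "p n = \<alpha> * v + \<beta> * (v + v')"
    "q (Suc n) = \<gamma> * u + \<delta> * (u + u')" "p (Suc n) = \<gamma> * v + \<delta> * (v + v')"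
    using assms unfolding orbit_in_cone_def by blast
  show ?thesis
    unfolding orbit_in_cone_def using *
    by (intro exI[of _ "\<alpha> + \<beta>"] exI[of _ \<beta>] exI[of _ "\<gamma> + \<delta>"] exI[of _ \<delta>])
      (auto simp: algebra_simps)
qed

lemma orbit_in_cone_right:
  assumes "orbit_in_cone n (u + u') (v + v') u' v'"
  shows "orbit_in_cone n u v u' v'"
proof -
  obtain \<alpha> \<beta> \<gamma> \<delta> where *: "0 \<le> \<alpha>" "0 \<le> \<beta>" "0 \<le> \<gamma>" "0 \<le> \<delta>"
    "q n = \<alpha> * (u + u') + \<beta> * u'" "p n = \<alpha> * (v + v') + \<beta> * v'"
    "q (Suc n) = \<gamma> * (u + u') + \<delta> * u'" "p (Suc n) = \<gamma> * (v + v') + \<delta> * v'"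
    using assms unfolding orbit_in_cone_def by blast
  show ?thesis
    unfolding orbit_in_cone_def using *
    by (intro exI[of _ \<alpha>] exI[of _ "\<alpha> + \<beta>"] exI[of _ \<gamma>] exI[of _ "\<gamma> + \<delta>"])
      (auto simp: algebra_simps)
qed

text \<open>The coefficient matrix has determinant 1, so \<alpha> and \<delta> are at least 1. As
  \<open>(u, v)\<close> does not come after \<open>v n\<close> in slope order,
  \<open>u / ht u v \<le> X n\<close>; if both heights are nonnegative, nothing cancels in
  \<open>x n \<le> 1\<close> and \<open>x (n + 1) \<le> 1\<close>.\<close>

lemma orbit_in_cone_height:
  assumes B: "farey_basis u v u' v'" and "orbit_in_cone n u v u' v'"
  shows "0 < ht u v" "of_int u \<le> X n * ht u v"
    "0 \<le> ht u' v' \<Longrightarrow> ht u' v' \<le> 1" "0 \<le> ht u' v' \<Longrightarrow> ht u v \<le> 1"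
proof -
  obtain \<alpha> \<beta> \<gamma> \<delta> where *: "0 \<le> \<alpha>" "0 \<le> \<beta>" "0 \<le> \<gamma>" "0 \<le> \<delta>"
    "q n = \<alpha> * u + \<beta> * u'" "p n = \<alpha> * v + \<beta> * v'"
    "q (Suc n) = \<gamma> * u + \<delta> * u'" "p (Suc n) = \<gamma> * v + \<delta> * v'"
    using assms(2) unfolding orbit_in_cone_def by blast
  have d: "u * v' - u' * v = 1" using B by (simp add: farey_basis_def)
  have "q n * p (Suc n) - q (Suc n) * p n = (\<alpha> * \<delta> - \<beta> * \<gamma>) * (u * v' - u' * v)"
    by (simp add: * algebra_simps)
  then have "\<alpha> * \<delta> = 1 + \<beta> * \<gamma>" by (simp add: d det)
  then have "0 < \<alpha> * \<delta>" using * by (simp add: add_pos_nonneg)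
  then have ad: "1 \<le> \<alpha>" "1 \<le> \<delta>" using * by (auto simp: zero_less_mult_iff)
  have u: "0 < u" using farey_basis_pos[OF B] by simp
  have "u * p n - q n * v = \<beta> * (u * v' - u' * v)" by (simp add: * algebra_simps)
  then have "u * p n - q n * v = \<beta>" by (simp add: d)
  then have "of_int (q n) * ht u v - of_int u * x n = a * of_int \<beta>"
    unfolding x_eq_ht ht_cross by simp
  then have le: "of_int u * x n \<le> of_int (q n) * ht u v"
    using ab * by (smt (verit) mult_nonneg_nonneg of_int_0_le_iff)
  then have "of_int u \<le> of_int (q n) * ht u v / x n"
    using x_pos[of n] by (simp add: field_simps)
  then show "of_int u \<le> X n * ht u v" by (simp add: X_def)
  have "0 < of_int u * x n" using u x_pos[of n] by simp
  then have "0 < of_int (q n) * ht u v" using le by linarith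
  then show pos: "0 < ht u v" using q_nonneg[of n] by (simp add: zero_less_mult_iff)
  have hn: "x n = of_int \<alpha> * ht u v + of_int \<beta> * ht u' v'"
    unfolding x_eq_ht * by (simp only: ht_add ht_mult)
  have hS: "x (Suc n) = of_int \<gamma> * ht u v + of_int \<delta> * ht u' v'"
    unfolding x_eq_ht * by (simp only: ht_add ht_mult)
  assume h': "0 \<le> ht u' v'"
  have "1 * ht u' v' \<le> of_int \<delta> * ht u' v'" using h' ad by (intro mult_right_mono) auto
  moreover have "0 \<le> of_int \<gamma> * ht u v" using pos * by simp
  ultimately show "ht u' v' \<le> 1" using hS x_le_1[of "Suc n"] by linarith
  have "1 * ht u v \<le> of_int \<alpha> * ht u v" using pos ad by (intro mult_right_mono) auto
  moreover have "0 \<le> of_int \<beta> * ht u' v'" using h' * by simp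
  ultimately show "ht u v \<le> 1" using hn x_le_1[of n] by linarith
qed

text \<open>The height of the second vector starts at \<open>- 1\<close> or above, because
  \<open>u * (- ht u' v') \<le> a \<le> 1\<close>, and grows by \<open>ht u v\<close> in every move.
  If it ends nonnegative it is at most 1, whence the factor 2.\<close>

lemma left_run:
  assumes B: "farey_basis u v u' v'" and j: "1 \<le> j"
    and C: "orbit_in_cone n u v (u' + j * u) (v' + j * v)"
  shows "1 \<le> u" "coprime u v" "0 < ht u v" "of_int j * ht u v \<le> 2" "of_int (j * u) \<le> 2 * X n"
proof -
  have B': "farey_basis u v (u' + j * u) (v' + j * v)"
    using B j by (auto simp: farey_basis_def algebra_simps)
  note hc = orbit_in_cone_height[OF B' C]
  show u: "1 \<le> u" using farey_basis_pos[OF B] by simp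
  show "coprime u v" using farey_basis_coprime[OF B] by simp
  show pos: "0 < ht u v" by (rule hc)
  have e: "of_int u' * ht u v - of_int u * ht u' v' = a"
    using B unfolding ht_cross by (simp add: farey_basis_def)
  have hw: "ht (u' + j * u) (v' + j * v) = ht u' v' + of_int j * ht u v"
    by (simp only: ht_add ht_mult)
  have u': "0 \<le> of_int u' * ht u v" using pos B by (simp add: farey_basis_def)
  have low: "- 1 \<le> ht u' v'"
  proof (rule ccontr)
    assume "\<not> - 1 \<le> ht u' v'"
    then have "1 * 1 < of_int u * (- ht u' v')" using u by (intro mult_le_less_imp_less) auto
    then show False using e ab u' by simp
  qed
  show h2: "of_int j * ht u v \<le> 2"
  proof (cases "0 \<le> ht (u' + j * u) (v' + j * v)")
    case True
    then show ?thesis using hc(3) low hw by linarith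
  next
    case False
    then show ?thesis using low hw by linarith
  qed
  have "of_int j * of_int u \<le> of_int j * (X n * ht u v)"
    using j hc(2) by (intro mult_left_mono) auto
  also have "\<dots> = X n * (of_int j * ht u v)" by simp
  also have "\<dots> \<le> X n * 2"
    by (rule mult_left_mono[OF h2 X_nonneg])
  finally show "of_int (j * u) \<le> 2 * X n" by simp
qed

text \<open>The height of the first vector changes by \<open>ht u' v'\<close> in every move and is
  still positive at the end. The alternatives are the vertical pivot \<open>(0, 1)\<close>, a pivot
  of positive height, with the bounds of a left run, and one of negative height, where the
  determinant identity gives \<open>u' * ht u v \<le> 1\<close> and with it the extra factor
  \<open>u'\<close>.\<close>

lemma right_run:
  assumes B: "farey_basis u v u' v'" and j: "1 \<le> j"
    and C: "orbit_in_cone n (u + j * u') (v + j * v') u' v'"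
  shows "u' = 0 \<and> of_int j \<le> 1 / a \<or>
    1 \<le> u' \<and> 0 < ht u' v' \<and> of_int j * ht u' v' \<le> 2 \<and> of_int (j * u') \<le> 2 * X n \<or>
    1 \<le> u' \<and> 0 < - ht u' v' \<and> of_int (j * u') * (- ht u' v') \<le> 1 \<and> of_int (j * u' * u') \<le> X n"
proof -
  have B': "farey_basis (u + j * u') (v + j * v') u' v'"
    using B j by (auto simp: farey_basis_def algebra_simps)
  note hc = orbit_in_cone_height[OF B' C]
  note X0 = X_nonneg[of n]
  have nn: "0 \<le> u" "0 \<le> v" "0 \<le> u'" "0 < v'" "0 < u"
    using B farey_basis_pos[OF B] by (auto simp: farey_basis_def)
  have e: "of_int u' * ht u v - of_int u * ht u' v' = a"
    using B unfolding ht_cross by (simp add: farey_basis_def)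
  have hv: "ht (u + j * u') (v + j * v') = ht u v + of_int j * ht u' v'"
    by (simp only: ht_add ht_mult)
  have ju: "of_int (j * u') \<le> X n * ht (u + j * u') (v + j * v')"
  proof -
    have "of_int (j * u') \<le> real_of_int (u + j * u')" using nn by simp
    then show ?thesis using hc(2) by linarith
  qed
  consider "u' = 0" | "1 \<le> u'" "0 < ht u' v'" | "1 \<le> u'" "ht u' v' < 0"
    using nn ht_nonzero[of u' v'] by (metis int_one_le_iff_zero_less linorder_neqE_linordered_idom order_le_less)
  then show ?thesis
  proof cases
    case 1
    then have "u * v' = 1" using B by (simp add: farey_basis_def)
    then have uv: "u = 1" "v' = 1" using nn by (auto simp: pos_zmult_eq_1_iff)
    then have "0 < b - of_int (v + j) * a" using hc(1) 1 by (simp add: ht_def)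
    moreover have "of_int j * a \<le> of_int (v + j) * a" using nn ab by (intro mult_right_mono) auto
    ultimately have "of_int j * a \<le> 1" using ab by linarith
    then show ?thesis using 1 ab by (simp add: field_simps)
  next
    case 2
    have C': "orbit_in_cone n u v u' v'"
    proof -
      have "orbit_in_cone n (u + int k * u') (v + int k * v') u' v' \<Longrightarrow> ?thesis" for k
      proof (induction k)
        case (Suc k)
        have "orbit_in_cone n (u + int k * u') (v + int k * v') u' v'"
          by (rule orbit_in_cone_right) (use Suc.prems in \<open>simp add: algebra_simps\<close>)
        then show ?case by (rule Suc.IH)
      qed simp
      from this[of "nat j"] C j show ?thesis by simp
    qed
    have h1: "ht (u + j * u') (v + j * v') \<le> 1" using hc(4) 2 by simp
    have "0 < ht u v" using orbit_in_cone_height(1)[OF B C'] .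
    then have "of_int j * ht u' v' \<le> 1" using h1 hv by linarith
    moreover have "X n * ht (u + j * u') (v + j * v') \<le> X n * 1"
      using h1 X0 by (rule mult_left_mono)
    then have "of_int (j * u') \<le> X n" using ju by linarith
    ultimately show ?thesis using 2 X0 by auto
  next
    case 3
    have up: "0 \<le> of_int u * (- ht u' v')" using nn 3 by (intro mult_nonneg_nonneg) auto
    have uh: "of_int u' * ht u v \<le> 1" using e ab up by simp
    have jh: "of_int j * (- ht u' v') \<le> ht u v" using hc(1) hv by simp
    have "of_int u' * (of_int j * (- ht u' v')) \<le> of_int u' * ht u v"
      using jh nn by (intro mult_left_mono) auto
    then have 31: "of_int (j * u') * (- ht u' v') \<le> 1" using uh by (simp add: ac_simps)
    have "of_int j * ht u' v' \<le> 0" using 3 j by (intro mult_nonneg_nonpos) auto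
    then have "X n * ht (u + j * u') (v + j * v') \<le> X n * ht u v"
      using X0 hv by (intro mult_left_mono) auto
    then have "of_int (j * u') \<le> X n * ht u v" using ju by linarith
    then have "of_int u' * of_int (j * u') \<le> of_int u' * (X n * ht u v)"
      using nn by (intro mult_left_mono) auto
    also have "\<dots> = X n * (of_int u' * ht u v)" by simp
    also have "\<dots> \<le> X n * 1" using uh X0 by (intro mult_left_mono)
    finally have "of_int (j * u' * u') \<le> X n" by (simp add: ac_simps)
    then show ?thesis using 3 31 by simp
  qed
qed

text \<open>With \<open>Y = X n = O(n)\<close> the hypotheses bound every run around a pivot below
  or above slope \<open>b / a\<close> by \<open>O(n powr t)\<close>. The number of runs is
  logarithmic, which is absorbed by passing to \<open>t'\<close>.\<close>

lemma f_upper_bound: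
  assumes t: "0 < t" "t < t'"
    and HA: "\<And>u v j Y. 1 \<le> u \<Longrightarrow> coprime u v \<Longrightarrow> 0 < ht u v \<Longrightarrow> 1 \<le> j \<Longrightarrow>
      of_int j * ht u v \<le> 2 \<Longrightarrow> of_int (j * u) \<le> 2 * Y \<Longrightarrow> of_int j \<le> A * Y powr t"
    and HB: "\<And>u v j Y. 1 \<le> u \<Longrightarrow> coprime u v \<Longrightarrow> 0 < - ht u v \<Longrightarrow> 1 \<le> j \<Longrightarrow>
      of_int (j * u) * (- ht u v) \<le> 1 \<Longrightarrow> of_int (j * u * u) \<le> Y \<Longrightarrow> of_int j \<le> B * Y powr t"
  obtains C where "0 < C" "\<And>n. 0 < n \<Longrightarrow> \<bar>of_int (f n)\<bar> \<le> C * real n powr t'"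
proof -
  obtain D where D: "0 < D" "\<And>n. X (Suc n) \<le> D * real (Suc n)"
    using X_linear_bound by blast
  have XD: "X n \<le> D * real n" if "0 < n" for n
    using D(2)[of "n - 1"] that by simp
  define C1 where "C1 = (\<bar>A\<bar> + \<bar>B\<bar>) * D powr t + 1 / a"
  have C1: "0 \<le> C1" using ab by (simp add: C1_def)
  \<comment> \<open>\<open>E * N\<^sup>2\<close> will bound the product of coordinate sums inside
    the logarithm; the 2 comes from \<open>n + 1 \<le> 2 * n\<close>. In \<open>C\<close>, the term
    \<open>2 / d\<close> comes from \<open>ln N \<le> N powr d / d\<close>.\<close>
  define E where "E = ((1 + b / a) * D)\<^sup>2 * 2 + 1"
  have E: "1 \<le> E" by (simp add: E_def)
  define d where "d = t' - t"
  have d: "0 < d" using t by (simp add: d_def)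
  define C where "C = 3 + C1 + C1 * ((ln E + 2 / d) / ln 2)"
  have C: "0 < C" using C1 E d by (auto simp: C_def intro!: add_pos_nonneg)
  have "\<bar>of_int (f n)\<bar> \<le> C * real n powr t'" if n: "0 < n" for n
  proof -
    define N where "N = real n"
    have N: "1 \<le> N" using n by (simp add: N_def)
    have N1: "1 \<le> N powr t" using N t by (simp add: ge_one_powr_ge_zero)
    define M where "M = (\<bar>A\<bar> + \<bar>B\<bar>) * X n powr t + 1 / a"
    have M0: "0 \<le> M" using ab by (simp add: M_def)
    note X0 = X_nonneg[of n]
    have "X n powr t \<le> (D * N) powr t" using XD[OF n] X0 t by (intro powr_mono2) (auto simp: N_def)
    then have XP: "X n powr t \<le> D powr t * N powr t" using D N by (simp add: powr_mult)
    have MC: "M \<le> C1 * N powr t"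
    proof -
      have "M \<le> (\<bar>A\<bar> + \<bar>B\<bar>) * (D powr t * N powr t) + 1 / a * N powr t"
        unfolding M_def using XP N1 ab by (intro add_mono mult_left_mono) (auto simp: divide_right_mono)
      then show ?thesis by (simp add: C1_def algebra_simps)
    qed
    have AM: "of_int j \<le> M" if "of_int j \<le> A * X n powr t \<or> of_int j \<le> B * X n powr t \<or> of_int j \<le> 1 / a" for j
    proof -
      have "A * X n powr t \<le> \<bar>A\<bar> * X n powr t" "B * X n powr t \<le> \<bar>B\<bar> * X n powr t"
        by (auto intro!: mult_right_mono)
      moreover have "0 \<le> \<bar>A\<bar> * X n powr t" "0 \<le> \<bar>B\<bar> * X n powr t" "0 \<le> 1 / a" using ab by auto
      ultimately show ?thesis using that unfolding M_def distrib_right by linarith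
    qed
    have "\<bar>of_int (f n)\<bar> \<le> 3 + M + M * log 2 (of_int (q n + p n) * of_int (q (Suc n) + p (Suc n)))"
    proof (rule stern_brocot_run_bound[OF stern_brocot_f[OF n], where P = "orbit_in_cone n"])
      show "orbit_in_cone n (q n) (p n) (q (Suc n)) (p (Suc n))" by (rule orbit_in_cone_self)
    next
      fix u v u' v' j
      assume "farey_basis u v u' v'" "1 \<le> j" "orbit_in_cone n u v (u' + j * u) (v' + j * v)"
      from left_run[OF this] this(2) show "of_int j \<le> M" by (intro AM disjI1 HA)
    next
      fix u v u' v' j
      assume *: "farey_basis u v u' v'" "1 \<le> j" "orbit_in_cone n (u + j * u') (v + j * v') u' v'"
      show "of_int j \<le> M"
        using right_run[OF *] HA[of u' v' j "X n"] HB[of u' v' j "X n"] *(2) farey_basis_coprime[OF *(1)]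
        by (intro AM) auto
    qed (auto intro: orbit_in_cone_left orbit_in_cone_right M0)
    also have "\<dots> \<le> 3 + M + M * ((ln E + 2 / d) / ln 2 * N powr d)"
    proof -
      have qp: "of_int (q m + p m) \<le> (1 + b / a) * D * real m" "1 \<le> real_of_int (q m + p m)" if "0 < m" for m
      proof -
        have "of_int (p m) * a \<le> of_int (q m) * b"
          using x_pos[of m] unfolding x_eq_ht by (simp add: ht_def)
        then have "of_int (p m) \<le> (b / a) * of_int (q m)" using ab by (simp add: field_simps)
        then have "of_int (q m + p m) \<le> (1 + b / a) * of_int (q m)" by (simp add: algebra_simps)
        also have "\<dots> \<le> (1 + b / a) * (D * real m)"
        proof -
          have "of_int (q m) = X m * x m" using x_pos[of m] by (simp add: X_def)
          also have "\<dots> \<le> X m * 1" using x_le_1[of m] X_nonneg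
            by (intro mult_left_mono)
          finally have "of_int (q m) \<le> D * real m" using XD[OF that] by simp
          then show ?thesis using ab by (intro mult_left_mono) auto
        qed
        finally show "of_int (q m + p m) \<le> (1 + b / a) * D * real m" by simp
        show "1 \<le> real_of_int (q m + p m)" using q_pos[OF that] p_nonneg[OF that] by linarith
      qed
      define R :: real where "R = of_int (q n + p n) * of_int (q (Suc n) + p (Suc n))"
      have R1: "1 \<le> R" using mult_mono[OF qp(2)[OF n] qp(2)[of "Suc n"]] qp(2)[OF n] by (simp add: R_def)
      have "R \<le> ((1 + b / a) * D * N) * ((1 + b / a) * D * (2 * N))"
        unfolding R_def
      proof (rule mult_mono)
        show "of_int (q n + p n) \<le> (1 + b / a) * D * N" using qp(1)[OF n] by (simp add: N_def)
        have "of_int (q (Suc n) + p (Suc n)) \<le> (1 + b / a) * D * real (Suc n)" by (rule qp) simp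
        also have "\<dots> \<le> (1 + b / a) * D * (2 * N)"
          using n ab D by (intro mult_left_mono) (auto simp: N_def)
        finally show "of_int (q (Suc n) + p (Suc n)) \<le> (1 + b / a) * D * (2 * N)" .
        show "0 \<le> real_of_int (q (Suc n) + p (Suc n))" using qp(2)[of "Suc n"] by linarith
        show "0 \<le> (1 + b / a) * D * N" using ab D N by simp
      qed
      also have "\<dots> = (E - 1) * N\<^sup>2" by (simp add: E_def power2_eq_square ac_simps)
      also have "\<dots> \<le> E * N\<^sup>2" by (intro mult_right_mono) auto
      finally have "ln R \<le> ln (E * N\<^sup>2)" using R1 by (subst ln_le_cancel_iff) auto
      also have "\<dots> = ln E + 2 * ln N" using E N by (simp add: ln_mult ln_realpow)
      also have "\<dots> \<le> ln E * N powr d + 2 * (N powr d / d)"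
      proof (rule add_mono)
        have "1 \<le> N powr d" using N d by (simp add: ge_one_powr_ge_zero)
        then show "ln E \<le> ln E * N powr d" using E by (simp add: mult_le_cancel_left1)
        show "2 * ln N \<le> 2 * (N powr d / d)" using ln_powr_bound[OF N d] by simp
      qed
      finally have "ln R \<le> (ln E + 2 / d) * N powr d" by (simp add: algebra_simps)
      then have "log 2 R \<le> (ln E + 2 / d) * N powr d / ln 2"
        unfolding log_def by (intro divide_right_mono) auto
      then have "M * log 2 R \<le> M * ((ln E + 2 / d) / ln 2 * N powr d)"
        using M0 by (intro mult_left_mono) auto
      then show ?thesis by (simp add: R_def)
    qed
    also have "\<dots> \<le> C * N powr t'"
    proof -
      have tt: "N powr t * N powr d = N powr t'" by (simp add: d_def flip: powr_add)
      have Nt: "N powr t \<le> N powr t'" using N t by (simp add: powr_mono)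
      have g: "0 \<le> (ln E + 2 / d) / ln 2 * N powr d" using E d by simp
      have "M * ((ln E + 2 / d) / ln 2 * N powr d)
          \<le> C1 * N powr t * ((ln E + 2 / d) / ln 2 * N powr d)"
        using MC g by (rule mult_right_mono)
      also have "\<dots> = C1 * ((ln E + 2 / d) / ln 2) * N powr t'"
        unfolding tt[symmetric] by (simp add: ac_simps)
      finally have 1: "M * ((ln E + 2 / d) / ln 2 * N powr d)
          \<le> C1 * ((ln E + 2 / d) / ln 2) * N powr t'" .
      have 2: "M \<le> C1 * N powr t'"
        using MC mult_left_mono[OF Nt C1] by linarith
      have 3: "3 \<le> 3 * N powr t'" using N1 Nt by linarith
      show ?thesis unfolding C_def distrib_right using 1 2 3 by linarith
    qed
    finally show ?thesis by (simp add: N_def)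
  qed
  then show ?thesis using that C by blast
qed

end

section \<open>Reduced fractions and Diophantine exponents\<close>

lemma reduced_denom_pos: "0 < reduced_denom r"
  by (simp add: reduced_denom_def quotient_of_denom_pos')

lemma reduced_denom_uminus: "reduced_denom (- r) = reduced_denom r"
  by (simp add: reduced_denom_def rat_uminus_code split_beta)

lemma reduced_denom_Fract: "0 < u \<Longrightarrow> coprime u v \<Longrightarrow> reduced_denom (Fract v u) = u"
  by (simp add: reduced_denom_def quotient_of_Fract normalize_stable coprime_commute)

lemma reduced_fraction:
  obtains v where "coprime (reduced_denom r) v" "r = Fract v (reduced_denom r)"
    "of_rat r = (of_int v / of_int (reduced_denom r) :: real)"
proof -
  obtain v u where vu: "quotient_of r = (v, u)" by (cases "quotient_of r")
  have "r = of_int v / of_int u" using vu by (rule quotient_of_div)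
  then have "r = Fract v u" by (simp add: Fract_of_int_quotient)
  moreover have "coprime u v" using quotient_of_coprime[OF vu] by (simp add: coprime_commute)
  moreover have "reduced_denom r = u" by (simp add: reduced_denom_def vu)
  moreover have "0 < u" using vu by (rule quotient_of_denom_pos)
  ultimately show ?thesis using that[of v] by (simp add: of_rat_rat)
qed

lemma reduced_denom_Fract_le:
  assumes "0 < n"
  shows "reduced_denom (Fract m n) \<le> n"
proof -
  define r where "r = Fract m n"
  obtain v where v: "coprime (reduced_denom r) v" "r = Fract v (reduced_denom r)"
    by (rule reduced_fraction)
  have "m * reduced_denom r = v * n"
    using v(2) assms reduced_denom_pos[of r] by (simp add: r_def eq_rat)
  then have "reduced_denom r dvd v * n" by (metis dvd_triv_right)
  then have "reduced_denom r dvd n" using v(1) by (simp add: coprime_dvd_mult_right_iff)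
  then show ?thesis using assms by (simp add: r_def zdvd_imp_le)
qed

text \<open>Negation exchanges approximation from above and from below and keeps reduced
  denominators, so the theory is developed for the odd exponent only.\<close>

lemma even_dioph_exponent_eq: "even_dioph_exponent s = odd_dioph_exponent (- s)"
proof -
  have "{r :: rat. 0 < - s - of_rat r \<and> - s - of_rat r < 1 / of_int (reduced_denom r) powr v}
      = uminus ` {r. 0 < of_rat r - s \<and> of_rat r - s < 1 / of_int (reduced_denom r) powr v}" for v
  proof (intro equalityI subsetI)
    fix r :: rat
    assume "r \<in> {r. 0 < - s - of_rat r \<and> - s - of_rat r < 1 / of_int (reduced_denom r) powr v}"
    then show "r \<in> uminus ` {r. 0 < of_rat r - s \<and> of_rat r - s < 1 / of_int (reduced_denom r) powr v}"
      by (intro image_eqI[of _ _ "- r"]) (auto simp: reduced_denom_uminus of_rat_minus)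
  qed (auto simp: reduced_denom_uminus of_rat_minus)
  then have "infinite {r :: rat. 0 < - s - of_rat r \<and> - s - of_rat r < 1 / of_int (reduced_denom r) powr v}
      \<longleftrightarrow> infinite {r :: rat. 0 < of_rat r - s \<and> of_rat r - s < 1 / of_int (reduced_denom r) powr v}" for v
    by (simp add: finite_image_iff inj_on_def)
  then show ?thesis by (simp add: even_dioph_exponent_def odd_dioph_exponent_def)
qed

text \<open>Rounding \<open>s * n\<close> down gives an error below \<open>1 / n\<close>, and
  cancelling only lowers the denominator. The bound keeps \<open>(e - c) / e\<close> away from
  nonpositive \<open>e\<close>.\<close>

lemma odd_dioph_exponent_ge_1:
  assumes "s \<notin> \<rat>"
  shows "1 \<le> odd_dioph_exponent s"
proof -
  define S where "S = {r :: rat. 0 < s - of_rat r \<and> s - of_rat r < 1 / of_int (reduced_denom r) powr 1}"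
  have "infinite S"
  proof
    assume fin: "finite S"
    define \<delta> where "\<delta> = Min (insert 1 ((\<lambda>r. s - of_rat r) ` S))"
    have "0 < \<delta>" using fin by (auto simp: \<delta>_def S_def)
    \<comment> \<open>\<open>1 / n\<close> is below every error occurring in \<open>S\<close>, so
      the fraction built from \<open>n\<close> is a new element.\<close>
    then obtain n where n: "1 / \<delta> < real n" using reals_Archimedean2 by blast
    have n0: "0 < real n" using n \<open>0 < \<delta>\<close> by (meson divide_pos_pos less_trans zero_less_one)
    define r where "r = Fract \<lfloor>s * real n\<rfloor> (int n)"
    have r: "of_rat r = of_int \<lfloor>s * real n\<rfloor> / real n"
      using n0 by (simp add: r_def of_rat_rat)
    have "s * real n \<noteq> of_int \<lfloor>s * real n\<rfloor>"
    proof
      assume "s * real n = of_int \<lfloor>s * real n\<rfloor>"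
      then have "s = of_int \<lfloor>s * real n\<rfloor> / of_int (int n)" using n0 by (simp add: field_simps)
      then show False using assms by (metis Rats_divide Rats_of_int)
    qed
    then have lt: "of_int \<lfloor>s * real n\<rfloor> < s * real n" by linarith
    have p1: "0 < s - of_rat r" using lt n0 by (simp add: r field_simps)
    have p2: "s - of_rat r < 1 / real n"
    proof -
      have "s * real n < of_int \<lfloor>s * real n\<rfloor> + 1" by linarith
      then have "s < (of_int \<lfloor>s * real n\<rfloor> + 1) / real n" using n0 by (simp add: field_simps)
      then show ?thesis by (simp add: r add_divide_distrib)
    qed
    have "reduced_denom r \<le> int n" unfolding r_def using n0 by (intro reduced_denom_Fract_le) simp
    then have "real_of_int (reduced_denom r) \<le> real n" by linarith
    then have "1 / real n \<le> 1 / of_int (reduced_denom r)"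
      using reduced_denom_pos[of r] by (intro divide_left_mono) auto
    then have "r \<in> S" using p1 p2 reduced_denom_pos[of r] by (simp add: S_def)
    then have "s - of_rat r \<in> (\<lambda>r. s - of_rat r) ` S" by blast
    then have "\<delta> \<le> s - of_rat r" unfolding \<delta>_def using fin by (intro Min_le) auto
    moreover have "1 / real n < \<delta>" using n n0 \<open>0 < \<delta>\<close> by (simp add: field_simps)
    ultimately show False using p2 by linarith
  qed
  then have "ereal 1 \<le> odd_dioph_exponent s"
    unfolding odd_dioph_exponent_def S_def by (intro Sup_upper) blast
  then show ?thesis by (simp add: one_ereal_def)
qed

text \<open>All but finitely many fractions satisfy the bound with constant 1; the exceptions are
  absorbed in \<open>c\<close>. The form \<open>u * s - v\<close> matches \<open>ht\<close>.\<close>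

lemma odd_dioph_exponent_less:
  assumes "odd_dioph_exponent s < ereal e"
  obtains c where "0 < c" "\<And>u v. 1 \<le> u \<Longrightarrow> coprime u v \<Longrightarrow> 0 < of_int u * s - of_int v \<Longrightarrow>
    c * of_int u powr (1 - e) \<le> of_int u * s - of_int v"
proof -
  define S where "S = {r :: rat. 0 < s - of_rat r \<and> s - of_rat r < 1 / of_int (reduced_denom r) powr e}"
  have fin: "finite S"
  proof (rule ccontr)
    assume "infinite S"
    then have "ereal e \<le> odd_dioph_exponent s"
      unfolding odd_dioph_exponent_def S_def by (intro Sup_upper) blast
    then show False using assms by simp
  qed
  define g where "g r = (s - of_rat r) * of_int (reduced_denom r) powr e" for r
  define c where "c = Min (insert 1 (g ` S))"
  have "0 < g r" if "r \<in> S" for r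
    using that reduced_denom_pos[of r] by (auto simp: g_def S_def intro!: mult_pos_pos)
  then have "0 < c" using fin by (auto simp: c_def)
  moreover have "c * of_int u powr (1 - e) \<le> of_int u * s - of_int v"
    if "1 \<le> u" "coprime u v" "0 < of_int u * s - of_int v" for u v
  proof -
    define r where "r = Fract v u"
    have d: "reduced_denom r = u" using that by (simp add: r_def reduced_denom_Fract)
    have r: "of_rat r = (of_int v / of_int u :: real)" using that by (simp add: r_def of_rat_rat)
    have pos: "0 < s - of_rat r" using that by (simp add: r field_simps)
    have up: "0 < real_of_int u" using that by simp
    have "c \<le> g r"
    proof (cases "r \<in> S")
      case True
      then have "g r \<in> g ` S" by blast
      then show ?thesis unfolding c_def using fin by (intro Min_le) auto
    next
      case False
      then have "1 / of_int u powr e \<le> s - of_rat r" using pos by (simp add: S_def d)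
      then have "1 \<le> g r" using up by (simp add: g_def d field_simps)
      moreover have "c \<le> 1" unfolding c_def using fin by (intro Min_le) auto
      ultimately show ?thesis by simp
    qed
    then have "c * of_int u powr (1 - e) \<le> g r * of_int u powr (1 - e)"
      by (intro mult_right_mono) auto
    also have "\<dots> = (s - of_rat r) * (of_int u powr e * of_int u powr (1 - e))"
      by (simp add: g_def d)
    also have "\<dots> = of_int u * s - of_int v"
      using up by (simp add: r field_simps flip: powr_add)
    finally show ?thesis .
  qed
  ultimately show ?thesis using that by blast
qed

text \<open>Bounded denominator and bounded value leave finitely many numerators. Hence infinitely
  many approximations have unbounded denominators.\<close>

lemma finite_bounded_denominators:
  fixes s :: real
  shows "finite {r :: rat. reduced_denom r \<le> N \<and> \<bar>s - of_rat r\<bar> \<le> 1}"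
proof -
  define B where "B = \<lceil>of_int \<bar>N\<bar> * (\<bar>s\<bar> + 1)\<rceil>"
  have "{r :: rat. reduced_denom r \<le> N \<and> \<bar>s - of_rat r\<bar> \<le> 1} \<subseteq> (\<lambda>(v, u). Fract v u) ` ({- B..B} \<times> {0..N})"
  proof
    fix r :: rat
    assume "r \<in> {r. reduced_denom r \<le> N \<and> \<bar>s - of_rat r\<bar> \<le> 1}"
    then have r: "reduced_denom r \<le> N" "\<bar>s - of_rat r\<bar> \<le> 1" by auto
    obtain v where v: "r = Fract v (reduced_denom r)"
      "of_rat r = (of_int v / of_int (reduced_denom r) :: real)"
      by (rule reduced_fraction)
    have "\<bar>of_int v / of_int (reduced_denom r) :: real\<bar> \<le> \<bar>s\<bar> + 1" using r(2) v(2) by linarith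
    then have "\<bar>of_int v\<bar> \<le> of_int (reduced_denom r) * (\<bar>s\<bar> + 1)"
      using reduced_denom_pos[of r] by (simp add: abs_divide field_simps)
    also have "\<dots> \<le> of_int \<bar>N\<bar> * (\<bar>s\<bar> + 1)"
      using r(1) by (intro mult_right_mono) (auto simp only: of_int_le_iff)
    also have "\<dots> \<le> of_int B" by (simp add: B_def)
    finally have "\<bar>v\<bar> \<le> B" by (simp flip: of_int_abs)
    then have "(v, reduced_denom r) \<in> {- B..B} \<times> {0..N}"
      using r(1) reduced_denom_pos[of r] by auto
    then show "r \<in> (\<lambda>(v, u). Fract v u) ` ({- B..B} \<times> {0..N})"
      by (rule rev_image_eqI) (simp flip: v(1))
  qed
  then show ?thesis by (rule finite_subset) simp
qed

lemma less_odd_dioph_exponent: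
  assumes "ereal e < odd_dioph_exponent s" "0 \<le> e"
  obtains e' where "e < e'" "\<And>N. \<exists>u v. N < u \<and> 1 \<le> u \<and> coprime u v \<and> 0 < of_int u * s - of_int v \<and>
    of_int u * s - of_int v < of_int u powr (1 - e')"
proof -
  obtain e' where e': "e < e'"
    and inf: "infinite {r :: rat. 0 < s - of_rat r \<and> s - of_rat r < 1 / of_int (reduced_denom r) powr e'}"
    using assms(1) unfolding odd_dioph_exponent_def less_Sup_iff by auto
  have "\<exists>u v. N < u \<and> 1 \<le> u \<and> coprime u v \<and> 0 < of_int u * s - of_int v \<and>
    of_int u * s - of_int v < of_int u powr (1 - e')" for N
  proof -
    have "\<not> {r :: rat. 0 < s - of_rat r \<and> s - of_rat r < 1 / of_int (reduced_denom r) powr e'}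
        \<subseteq> {r. reduced_denom r \<le> N \<and> \<bar>s - of_rat r\<bar> \<le> 1}"
      using inf finite_bounded_denominators finite_subset by blast
    then obtain r where r: "0 < s - of_rat r" "s - of_rat r < 1 / of_int (reduced_denom r) powr e'"
      "\<not> (reduced_denom r \<le> N \<and> \<bar>s - of_rat r\<bar> \<le> 1)"
      by blast
    define u where "u = reduced_denom r"
    have u: "1 \<le> u" using reduced_denom_pos[of r] by (simp add: u_def)
    then have up: "0 < real_of_int u" by simp
    obtain v where v: "coprime u v" "of_rat r = (of_int v / of_int u :: real)"
      unfolding u_def by (rule reduced_fraction)
    have "1 \<le> of_int u powr e'" using u assms(2) e' by (intro ge_one_powr_ge_zero) auto
    then have "1 / of_int u powr e' \<le> 1" by (auto simp: divide_le_eq_1)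
    then have "s - of_rat r \<le> 1" using r(2) by (simp add: u_def)
    then have "N < u" using r by (simp add: u_def)
    moreover have "0 < of_int u * s - of_int v" using r(1) up by (simp add: v field_simps)
    moreover have "of_int u * s - of_int v < of_int u powr (1 - e')"
    proof -
      have "of_int u * s - of_int v = of_int u * (s - of_rat r)" using up by (simp add: v field_simps)
      also have "\<dots> < of_int u * (1 / of_int u powr e')"
        using r(2) up by (intro mult_strict_left_mono) (auto simp: u_def)
      also have "\<dots> = of_int u powr (1 - e')" using up by (simp add: powr_diff)
      finally show ?thesis .
    qed
    ultimately show ?thesis using u v(1) by blast
  qed
  then show ?thesis using e' that by blast
qed

section \<open>Exponent ratios and criteria for the limsup\<close>

lemma exponent_ratio_real: "exponent_ratio (ereal c) (ereal e) = ereal ((e - c) / e)" if "e \<noteq> 0"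
  using that by (simp add: exponent_ratio_def)

text \<open>For finite \<open>e\<close> the inequality \<open>(e - c) / e < t\<close> is
  \<open>e * (1 - t) < c\<close>; an infinite exponent has ratio 1, which \<open>t < 1\<close>
  excludes.\<close>

lemma exponent_ratio_less_imp:
  assumes "exponent_ratio (ereal c) E < ereal t" "t < 1" "1 \<le> E"
  shows "E < ereal (c / (1 - t))"
proof (cases E)
  case (real e)
  then have e: "1 \<le> e" using assms(3) by simp
  then have "(e - c) / e < t" using assms(1) real by (simp add: exponent_ratio_real)
  then have "e - c < t * e" using e by (simp add: field_simps)
  then have "e * (1 - t) < c" by (simp add: algebra_simps)
  then have "e < c / (1 - t)" using assms(2) by (simp add: field_simps)
  then show ?thesis using real by simp
next
  case PInf
  then show ?thesis using assms by (simp add: exponent_ratio_def)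
next
  case MInf
  then show ?thesis by simp
qed

lemma less_exponent_ratio_imp:
  assumes "ereal t < exponent_ratio (ereal c) E" "0 \<le> c" "1 \<le> E"
  shows "t < 1" "ereal (c / (1 - t)) < E"
proof -
  have "t < 1 \<and> ereal (c / (1 - t)) < E"
  proof (cases E)
    case (real e)
    then have e: "1 \<le> e" using assms(3) by simp
    then have l: "t < (e - c) / e" using assms(1) real by (simp add: exponent_ratio_real)
    also have "\<dots> \<le> 1" using e assms(2) by (simp add: field_simps)
    finally have t: "t < 1" .
    have "c < e * (1 - t)" using e l by (simp add: field_simps)
    then have "c / (1 - t) < e" using t by (simp add: field_simps)
    then show ?thesis using real t by simp
  next
    case PInf
    then show ?thesis using assms by (simp add: exponent_ratio_def)
  next
    case MInf
    then show ?thesis using assms(3) by simp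
  qed
  then show "t < 1" "ereal (c / (1 - t)) < E" by auto
qed

lemma log_quotient_ereal:
  assumes "2 \<le> n" "y \<noteq> 0"
  shows "log_abs y / ereal (ln (real n)) = ereal (ln \<bar>y\<bar> / ln (real n))"
  using assms by (simp add: log_abs_def)

lemma limsup_log_le:
  fixes f :: "nat \<Rightarrow> int"
  assumes "0 < C" "\<And>n. 0 < n \<Longrightarrow> \<bar>of_int (f n)\<bar> \<le> C * real n powr t"
  shows "limsup (\<lambda>n. log_abs (of_int (f n)) / ereal (ln (real n))) \<le> ereal t"
proof -
  \<comment> \<open>From \<open>n = 2\<close> on the denominator is positive, so
    \<open>f n = 0\<close> contributes \<open>- \<infinity>\<close>; the term with
    \<open>ln C\<close> vanishes in the limit.\<close>
  have "log_abs (of_int (f n)) / ereal (ln (real n)) \<le> ereal (t + ln C / ln (real n))"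
    if n: "2 \<le> n" for n
  proof (cases "f n = 0")
    case True
    have "0 < ln (real n)" using n by simp
    then have "log_abs (of_int (f n)) / ereal (ln (real n)) = - \<infinity>"
      using True by (simp add: log_abs_def divide_ereal_def)
    then show ?thesis by simp
  next
    case False
    have l: "0 < ln (real n)" using n by simp
    have "ln \<bar>real_of_int (f n)\<bar> \<le> ln (C * real n powr t)"
      using assms(2)[of n] n False by (subst ln_le_cancel_iff) (auto simp: assms)
    also have "\<dots> = ln C + t * ln (real n)" using assms(1) n by (simp add: ln_mult ln_powr)
    finally have "ln \<bar>real_of_int (f n)\<bar> / ln (real n) \<le> (ln C + t * ln (real n)) / ln (real n)"
      using l by (intro divide_right_mono) auto
    also have "\<dots> = t + ln C / ln (real n)" using l by (simp add: field_simps)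
    finally show ?thesis using n False by (simp add: log_quotient_ereal)
  qed
  then have "limsup (\<lambda>n. log_abs (of_int (f n)) / ereal (ln (real n)))
      \<le> limsup (\<lambda>n. ereal (t + ln C / ln (real n)))"
    by (intro Limsup_mono eventually_sequentiallyI[of 2])
  also have "\<dots> = ereal t"
  proof (rule lim_imp_Limsup)
    have "filterlim (\<lambda>n. ln (real n)) at_top sequentially"
      by (rule filterlim_compose[OF ln_at_top filterlim_real_sequentially])
    then have "(\<lambda>n. ln C / ln (real n)) \<longlonglongrightarrow> 0"
      by (intro tendsto_divide_0[OF tendsto_const] filterlim_at_top_imp_at_infinity)
    then have "(\<lambda>n. t + ln C / ln (real n)) \<longlonglongrightarrow> t + 0" by (intro tendsto_intros)
    then show "(\<lambda>n. ereal (t + ln C / ln (real n))) \<longlonglongrightarrow> ereal t" by simp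
  qed simp
  finally show ?thesis .
qed

lemma le_limsup_log:
  fixes f :: "nat \<Rightarrow> int"
  assumes "\<And>N. \<exists>n\<ge>N. f n \<noteq> 0 \<and> real n powr t \<le> \<bar>of_int (f n)\<bar>"
  shows "ereal t \<le> limsup (\<lambda>n. log_abs (of_int (f n)) / ereal (ln (real n)))"
  unfolding limsup_INF_SUP
proof (rule INF_greatest)
  fix N :: nat
  obtain n where n: "max N 2 \<le> n" "f n \<noteq> 0" "real n powr t \<le> \<bar>of_int (f n)\<bar>"
    using assms by blast
  have l: "0 < ln (real n)" using n(1) by simp
  have "ln (real n powr t) \<le> ln \<bar>real_of_int (f n)\<bar>"
    using n by (subst ln_le_cancel_iff) auto
  then have "t * ln (real n) \<le> ln \<bar>real_of_int (f n)\<bar>" using n(1) by (simp add: ln_powr)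
  then have "t \<le> ln \<bar>real_of_int (f n)\<bar> / ln (real n)" using l by (simp add: field_simps)
  then have "ereal t \<le> log_abs (of_int (f n)) / ereal (ln (real n))"
    using n by (simp add: log_quotient_ereal)
  then show "ereal t \<le> (SUP n\<in>{N..}. log_abs (of_int (f n)) / ereal (ln (real n)))"
    using n(1) by (intro SUP_upper2[of n]) auto
qed

text \<open>\<open>n powr t\<close> is at most of order \<open>Y powr (t * \<sigma>)\<close>, a
  smaller power than the size \<open>Y\<close> of \<open>f n\<close>; the slack absorbs both
  constants.\<close>

lemma le_limsup_log_criterion:
  fixes f :: "nat \<Rightarrow> int"
  assumes t: "0 < t" "t * \<sigma> < 1" and cC: "0 < c" "0 < C"
    and ex: "\<And>M. \<exists>n Y. M \<le> Y \<and> c * Y \<le> \<bar>of_int (f n)\<bar> \<and> real n \<le> C * Y powr \<sigma>"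
  shows "ereal t \<le> limsup (\<lambda>n. log_abs (of_int (f n)) / ereal (ln (real n)))"
proof (rule le_limsup_log)
  fix N :: nat
  define d where "d = 1 - t * \<sigma>"
  have d: "0 < d" using t by (simp add: d_def)
  define F where "F = (\<Sum>i<N. \<bar>real_of_int (f i)\<bar>)"
  have F: "0 \<le> F" by (simp add: F_def sum_nonneg)
  \<comment> \<open>The first summand forces \<open>c * Y > F\<close>, hence
    \<open>n \<ge> N\<close>; the second makes \<open>Y powr d\<close> dominate the
    constants.\<close>
  define M where "M = (1 + F) / c + (C powr t / c) powr (1 / d)"
  obtain n Y where n: "M \<le> Y" "c * Y \<le> \<bar>of_int (f n)\<bar>" "real n \<le> C * Y powr \<sigma>" using ex by blast
  have "(1 + F) / c \<le> Y" using n(1) by (simp add: M_def) (smt (verit) powr_ge_zero)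
  then have FY: "1 + F \<le> c * Y" using cC by (simp add: field_simps)
  have "0 < c * Y" using FY F by linarith
  then have Y: "0 < Y" using cC by (simp add: zero_less_mult_iff)
  have "(C powr t / c) powr (1 / d) \<le> Y"
    using n(1) F cC by (simp add: M_def) (smt (verit) divide_nonneg_pos)
  then have "((C powr t / c) powr (1 / d)) powr d \<le> Y powr d"
    using d by (intro powr_mono2) auto
  then have "C powr t / c \<le> Y powr d" using d cC by (simp add: powr_powr)
  then have "C powr t * Y powr (t * \<sigma>) \<le> c * Y powr d * Y powr (t * \<sigma>)"
    using cC by (intro mult_right_mono) (auto simp: field_simps)
  also have "\<dots> = c * Y" using Y by (simp add: d_def flip: powr_add)
  finally have CY: "C powr t * Y powr (t * \<sigma>) \<le> c * Y" .
  have "real n powr t \<le> (C * Y powr \<sigma>) powr t" using n(3) t by (intro powr_mono2) auto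
  also have "\<dots> = C powr t * Y powr (t * \<sigma>)" using cC by (simp add: powr_mult powr_powr ac_simps)
  finally have "real n powr t \<le> \<bar>of_int (f n)\<bar>" using CY n(2) by linarith
  moreover have "N \<le> n"
  proof (rule ccontr)
    assume "\<not> N \<le> n"
    then have "\<bar>real_of_int (f n)\<bar> \<le> F" unfolding F_def by (intro member_le_sum) auto
    then show False using FY n(2) by linarith
  qed
  moreover have "f n \<noteq> 0" using FY F n(2) by auto
  ultimately show "\<exists>n\<ge>N. f n \<noteq> 0 \<and> real n powr t \<le> \<bar>of_int (f n)\<bar>" by blast
qed

text \<open>Interpolates between a Diophantine bound on \<open>j\<close> and the trivial one.\<close>

lemma powr_interpolate:
  fixes j w B Y t :: real
  assumes "0 < t" "t < 1" "0 < j" "0 < w" "0 < B" "j \<le> B * w powr (t / (1 - t))" "j * w \<le> Y"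
  shows "j \<le> B powr (1 - t) * Y powr t"
proof -
  have "j powr (1 - t) \<le> (B * w powr (t / (1 - t))) powr (1 - t)"
    using assms by (intro powr_mono2) auto
  also have "\<dots> = B powr (1 - t) * w powr t"
    using assms by (simp add: powr_mult powr_powr)
  finally have 1: "j powr (1 - t) \<le> B powr (1 - t) * w powr t" .
  have "j = j powr (1 - t) * j powr t" using assms by (simp flip: powr_add)
  also have "\<dots> \<le> B powr (1 - t) * w powr t * j powr t" using 1 by (intro mult_right_mono) auto
  also have "\<dots> = B powr (1 - t) * (j * w) powr t" using assms by (simp add: powr_mult)
  also have "\<dots> \<le> B powr (1 - t) * Y powr t"
    using assms by (intro mult_left_mono powr_mono2) auto
  finally show ?thesis .
qed

section \<open>Upper bound for the limsup\<close>

context bcz_orbit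
begin

lemma ht_eq: "ht u v = a * (of_int u * (b / a) - of_int v)"
  using ab by (simp add: ht_def field_simps)

text \<open>For \<open>e = 1 / (1 - t)\<close> one has \<open>e - 1 = t / (1 - t)\<close>, so the
  Diophantine bound turns \<open>j \<le> 2 / ht u v\<close> into the interpolation hypothesis with
  weight \<open>u\<close>. For \<open>t \<ge> 1\<close> the bound
  \<open>j \<le> j * u \<le> 2 * Y\<close> is enough.\<close>

lemma odd_run_bound:
  assumes t: "0 < t" "exponent_ratio 1 (odd_dioph_exponent (b / a)) < ereal t"
  obtains A where "\<And>u v j Y. 1 \<le> u \<Longrightarrow> coprime u v \<Longrightarrow> 0 < ht u v \<Longrightarrow> 1 \<le> j \<Longrightarrow>
      of_int j * ht u v \<le> 2 \<Longrightarrow> of_int (j * u) \<le> 2 * Y \<Longrightarrow> of_int j \<le> A * Y powr t"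
proof (cases "t < 1")
  case True
  define e where "e = 1 / (1 - t)"
  have "odd_dioph_exponent (b / a) < ereal e"
    using exponent_ratio_less_imp[of 1, OF _ True odd_dioph_exponent_ge_1[OF irrational]] t
    by (simp add: e_def one_ereal_def)
  then obtain c where c: "0 < c" "\<And>u v. 1 \<le> u \<Longrightarrow> coprime u v \<Longrightarrow> 0 < of_int u * (b / a) - of_int v \<Longrightarrow>
    c * of_int u powr (1 - e) \<le> of_int u * (b / a) - of_int v"
    by (rule odd_dioph_exponent_less) blast
  define B where "B = 2 / (a * c)"
  have "of_int j \<le> B powr (1 - t) * 2 powr t * Y powr t"
    if "1 \<le> u" "coprime u v" "0 < ht u v" "1 \<le> j" "of_int j * ht u v \<le> 2" "of_int (j * u) \<le> 2 * Y"
    for u v j Y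
  proof -
    have up: "0 < real_of_int u" "0 < real_of_int j" using that by auto
    have "0 < of_int u * (b / a) - of_int v" using that(3) ab unfolding ht_eq by (simp add: zero_less_mult_iff)
    then have "a * (c * of_int u powr (1 - e)) \<le> ht u v"
      unfolding ht_eq using c(2)[OF that(1,2)] ab by (intro mult_left_mono) auto
    then have "of_int j * (a * (c * of_int u powr (1 - e))) \<le> of_int j * ht u v"
      using up by (intro mult_left_mono) auto
    also have "\<dots> \<le> 2" by (rule that)
    finally have *: "of_int j * (a * (c * of_int u powr (1 - e))) \<le> 2" .
    have e: "1 - e = - (t / (1 - t))" using True by (simp add: e_def field_simps)
    have "of_int j \<le> B * of_int u powr (t / (1 - t))"
      using * up ab c(1) unfolding e powr_minus B_def by (simp add: field_simps)
    then have "of_int j \<le> B powr (1 - t) * (2 * Y) powr t"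
      using that up ab c(1) t True by (intro powr_interpolate) (auto simp: B_def)
    moreover have "0 < 2 * Y"
    proof -
      have "0 < real_of_int (j * u)" using up by simp
      then show ?thesis using that(6) by linarith
    qed
    ultimately show ?thesis by (simp add: powr_mult ac_simps)
  qed
  then show ?thesis using that by blast
next
  case False
  have "of_int j \<le> 2 powr t * Y powr t"
    if "1 \<le> u" "1 \<le> j" "of_int (j * u) \<le> 2 * Y" for u v j :: int and Y :: real
  proof -
    have "j * 1 \<le> j * u" using that by (intro mult_left_mono) auto
    then have "real_of_int j \<le> 2 * Y" using that(3) by linarith
    moreover from this have "1 \<le> 2 * Y" using that by linarith
    then have "(2 * Y) powr 1 \<le> (2 * Y) powr t" using False by (intro powr_mono) auto
    ultimately show ?thesis using \<open>1 \<le> 2 * Y\<close> by (simp add: powr_mult)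
  qed
  then show ?thesis using that by blast
qed

text \<open>As for the odd exponent, but with weight \<open>u * u\<close>: here
  \<open>j \<le> 1 / (u * \<bar>ht u v\<bar>)\<close>, and for \<open>e = 2 / (1 - t)\<close> the
  power \<open>e - 2\<close> is twice \<open>t / (1 - t)\<close>.\<close>

lemma even_run_bound:
  assumes t: "0 < t" "exponent_ratio 2 (even_dioph_exponent (b / a)) < ereal t"
  obtains A where "\<And>u v j Y. 1 \<le> u \<Longrightarrow> coprime u v \<Longrightarrow> 0 < - ht u v \<Longrightarrow> 1 \<le> j \<Longrightarrow>
      of_int (j * u) * (- ht u v) \<le> 1 \<Longrightarrow> of_int (j * u * u) \<le> Y \<Longrightarrow> of_int j \<le> A * Y powr t"
proof (cases "t < 1")
  case True
  define e where "e = 2 / (1 - t)"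
  have "- (b / a) \<notin> \<rat>" using irrational by simp
  then have "odd_dioph_exponent (- (b / a)) < ereal e"
    using exponent_ratio_less_imp[of 2, OF _ True odd_dioph_exponent_ge_1] t
    by (simp add: e_def even_dioph_exponent_eq)
  then obtain c where c: "0 < c" "\<And>u v. 1 \<le> u \<Longrightarrow> coprime u v \<Longrightarrow> 0 < of_int u * (- (b / a)) - of_int v \<Longrightarrow>
    c * of_int u powr (1 - e) \<le> of_int u * (- (b / a)) - of_int v"
    by (rule odd_dioph_exponent_less) blast
  define B where "B = 1 / (a * c)"
  have "of_int j \<le> B powr (1 - t) * Y powr t"
    if "1 \<le> u" "coprime u v" "0 < - ht u v" "1 \<le> j" "of_int (j * u) * (- ht u v) \<le> 1"
      "of_int (j * u * u) \<le> Y" for u v j Y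
  proof -
    have up: "0 < real_of_int u" "0 < real_of_int j" using that by auto
    have h: "- ht u v = a * (of_int u * (- (b / a)) - of_int (- v))"
      unfolding ht_eq by (simp add: algebra_simps)
    have "0 < of_int u * (- (b / a)) - of_int (- v)"
      using that(3) ab unfolding h by (simp only: zero_less_mult_iff) auto
    then have "a * (c * of_int u powr (1 - e)) \<le> - ht u v"
      unfolding h using c(2)[of u "- v"] that(1,2) ab by (intro mult_left_mono) auto
    then have "of_int (j * u) * (a * (c * of_int u powr (1 - e))) \<le> of_int (j * u) * (- ht u v)"
      using up by (intro mult_left_mono) auto
    also have "\<dots> \<le> 1" by (rule that)
    finally have *: "of_int (j * u) * (a * (c * of_int u powr (1 - e))) \<le> 1" .
    define \<tau> where "\<tau> = t / (1 - t)"
    have "1 / (1 - t) = 1 + \<tau>" using True by (simp add: \<tau>_def field_simps)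
    then have e: "1 - e = - 1 - \<tau> - \<tau>" unfolding e_def by (simp add: field_simps)
    have "of_int u powr (1 - e) = inverse (of_int u * (of_int (u * u) powr \<tau>))"
    proof -
      have "of_int u powr (1 - e) = of_int u powr (- 1) * of_int u powr (- \<tau>) * of_int u powr (- \<tau>)"
        unfolding e powr_add[symmetric] by simp
      also have "\<dots> = inverse (of_int u * (of_int (u * u) powr \<tau>))"
        using up by (simp add: powr_minus powr_mult inverse_mult_distrib ac_simps)
      finally show ?thesis .
    qed
    then have "of_int (j * u) * (a * (c * of_int u powr (1 - e)))
        = of_int j * (a * c) / of_int (u * u) powr \<tau>"
      using up by (simp add: divide_inverse inverse_mult_distrib)
    then have "of_int j * (a * c) \<le> of_int (u * u) powr \<tau>"
      using * up by (simp add: divide_le_eq_1)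
    then have "of_int j \<le> B * of_int (u * u) powr \<tau>"
      using ab c(1) unfolding B_def by (simp add: pos_le_divide_eq)
    then show ?thesis
      using that up ab c(1) t True
      by (intro powr_interpolate[of _ _ "of_int (u * u)"]) (auto simp: B_def \<tau>_def ac_simps)
  qed
  then show ?thesis using that by blast
next
  case False
  have "of_int j \<le> 1 * Y powr t"
    if "1 \<le> u" "1 \<le> j" "of_int (j * u * u) \<le> Y" for u v j :: int and Y :: real
  proof -
    have "1 * 1 \<le> u * u" using that by (intro mult_mono) auto
    then have "j * 1 \<le> j * (u * u)" using that by (intro mult_left_mono) auto
    then have "real_of_int j \<le> real_of_int (j * u * u)" by (simp add: ac_simps flip: of_int_mult)
    then have "real_of_int j \<le> Y" using that(3) by linarith
    moreover from this have "1 \<le> Y" using that by linarith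
    then have "Y powr 1 \<le> Y powr t" using False by (intro powr_mono) auto
    ultimately show ?thesis using \<open>1 \<le> Y\<close> by simp
  qed
  then show ?thesis using that by blast
qed

lemma limsup_upper:
  assumes "exponent_ratio 1 (odd_dioph_exponent (b / a)) < ereal t"
    "exponent_ratio 2 (even_dioph_exponent (b / a)) < ereal t" "0 < t" "t < t'"
  shows "limsup (\<lambda>n. log_abs (of_int (f n)) / ereal (ln (real n))) \<le> ereal t'"
proof -
  obtain A where A: "\<And>u v j Y. 1 \<le> u \<Longrightarrow> coprime u v \<Longrightarrow> 0 < ht u v \<Longrightarrow> 1 \<le> j \<Longrightarrow>
      of_int j * ht u v \<le> 2 \<Longrightarrow> of_int (j * u) \<le> 2 * Y \<Longrightarrow> of_int j \<le> A * Y powr t"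
    by (rule odd_run_bound[OF assms(3,1)]) blast
  obtain B where B: "\<And>u v j Y. 1 \<le> u \<Longrightarrow> coprime u v \<Longrightarrow> 0 < - ht u v \<Longrightarrow> 1 \<le> j \<Longrightarrow>
      of_int (j * u) * (- ht u v) \<le> 1 \<Longrightarrow> of_int (j * u * u) \<le> Y \<Longrightarrow> of_int j \<le> B * Y powr t"
    by (rule even_run_bound[OF assms(3,2)]) blast
  obtain C where "0 < C" "\<And>n. 0 < n \<Longrightarrow> \<bar>of_int (f n)\<bar> \<le> C * real n powr t'"
    by (rule f_upper_bound[OF assms(3,4) A B]) blast+
  then show ?thesis by (rule limsup_log_le)
qed

text \<open>Nonzero integers have logarithm at least 0. This disposes of exponents
  \<open>t \<le> 0\<close> in the lower bound.\<close>

lemma limsup_nonneg: "0 \<le> limsup (\<lambda>n. log_abs (of_int (f n)) / ereal (ln (real n)))"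
proof -
  have "\<exists>n\<ge>N. f n \<noteq> 0 \<and> real n powr 0 \<le> \<bar>of_int (f n)\<bar>" for N
  proof -
    obtain n where "max N 1 \<le> n" "f n \<noteq> 0" using f_nonzero_frequently by blast
    moreover from this have "1 \<le> \<bar>f n\<bar>" by linarith
    then have "1 \<le> \<bar>real_of_int (f n)\<bar>" by linarith
    ultimately show ?thesis by (intro exI[of _ n]) auto
  qed
  then have "ereal 0 \<le> limsup (\<lambda>n. log_abs (of_int (f n)) / ereal (ln (real n)))"
    by (rule le_limsup_log)
  then show ?thesis by (simp add: zero_ereal_def)
qed

end

section \<open>Lower bound for the limsup\<close>

context bcz_orbit
begin

lemma index_le_X: "real n \<le> X n / a"
  using X_ge[of n] ab by (simp add: field_simps)

text \<open>A good approximation from below is an orbit vector of height \<open>1 / Y\<close>, and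
  the entry there exceeds \<open>Y - 1\<close>, so one of two neighbouring sums has size at least
  \<open>Y / 4\<close>. Its index is at most \<open>u * Y / a\<close> with
  \<open>u \<le> Y powr (1 / (e - 1))\<close>, whence \<sigma>.\<close>

lemma limsup_lower_odd:
  assumes t: "0 < t" "ereal t < exponent_ratio 1 (odd_dioph_exponent (b / a))"
  shows "ereal t \<le> limsup (\<lambda>n. log_abs (of_int (f n)) / ereal (ln (real n)))"
proof -
  have t1: "t < 1" and "ereal (1 / (1 - t)) < odd_dioph_exponent (b / a)"
    using less_exponent_ratio_imp[of t 1, OF _ _ odd_dioph_exponent_ge_1[OF irrational]] t
    by (auto simp: one_ereal_def)
  then obtain e where e: "1 / (1 - t) < e"
    and ap: "\<And>N. \<exists>u v. N < u \<and> 1 \<le> u \<and> coprime u v \<and> 0 < of_int u * (b / a) - of_int v \<and>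
      of_int u * (b / a) - of_int v < of_int u powr (1 - e)"
    by (elim less_odd_dioph_exponent) auto
  have "1 < 1 / (1 - t)" using t t1 by simp
  then have e1: "1 < e" using e by linarith
  define \<sigma> where "\<sigma> = 1 + 1 / (e - 1)"
  have "1 < e * (1 - t)" using e t1 by (simp add: field_simps)
  then have ts: "t * \<sigma> < 1" using e1 by (simp add: \<sigma>_def field_simps)
  show ?thesis
  proof (rule le_limsup_log_criterion[OF t(1) ts, of "1 / 4" "1 / a"])
    fix M :: real
    \<comment> \<open>The 8 absorbs the additive error in
      \<open>Y - 4 \<le> \<bar>f n\<bar> + \<bar>f m\<bar>\<close> and gives height at most
      1.\<close>
    define R where "R = max M 8"
    obtain u v where u: "\<lceil>R powr (1 / (e - 1))\<rceil> < u" "1 \<le> u" "coprime u v"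
      "0 < of_int u * (b / a) - of_int v" "of_int u * (b / a) - of_int v < of_int u powr (1 - e)"
      using ap by blast
    have up: "0 < real_of_int u" using u by simp
    define Y where "Y = 1 / ht u v"
    have h0: "0 < ht u v" unfolding ht_eq using u ab by simp
    have "ht u v \<le> 1 * (of_int u * (b / a) - of_int v)"
      unfolding ht_eq using u ab by (intro mult_right_mono) auto
    then have h: "ht u v < of_int u powr (1 - e)" using u by simp
    have uY: "of_int u powr (e - 1) \<le> Y"
    proof -
      have "of_int u powr (e - 1) * of_int u powr (1 - e) = 1" using up by (simp flip: powr_add)
      moreover have "of_int u powr (e - 1) * ht u v \<le> of_int u powr (e - 1) * of_int u powr (1 - e)"
        using h by (intro mult_left_mono) auto
      ultimately show ?thesis using h0 by (simp add: Y_def field_simps)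
    qed
    have "R powr (1 / (e - 1)) \<le> of_int u" using u(1) by linarith
    then have "(R powr (1 / (e - 1))) powr (e - 1) \<le> of_int u powr (e - 1)"
      using e1 by (intro powr_mono2) auto
    moreover have "(R powr (1 / (e - 1))) powr (e - 1) = R" using e1 by (simp add: powr_powr R_def)
    ultimately have RY: "R \<le> Y" using uY by linarith
    then have Y8: "8 \<le> Y" "M \<le> Y" by (auto simp: R_def)
    have "ht u v \<le> 1" using Y8 h0 by (simp add: Y_def field_simps)
    then obtain n where n: "0 < n" "q n = u" "p n = v" using orbit_complete[OF u(2,3) h0] by blast
    then obtain m where m: "n = Suc m" using gr0_implies_Suc by blast
    have xn: "x n = ht u v" by (simp add: x_eq_ht n)
    have "Y \<le> (1 + x m) / x n"
      unfolding Y_def xn using h0 x_pos[of m] by (intro divide_right_mono) auto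
    then have "Y < of_int (K m) + 1" using K_floor(2)[of m] m by simp
    then have "Y - 4 \<le> \<bar>of_int (f n)\<bar> + \<bar>of_int (f m)\<bar>" by (simp add: m f_Suc)
    then consider "1 / 4 * Y \<le> \<bar>of_int (f n)\<bar>" | "1 / 4 * Y \<le> \<bar>of_int (f m)\<bar>" using Y8 by linarith
    then obtain i where i: "i \<le> n" "1 / 4 * Y \<le> \<bar>of_int (f i)\<bar>"
    proof cases
      case 1
      then show ?thesis using that[of n] by simp
    next
      case 2
      then show ?thesis using that[of m] m by simp
    qed
    have "real i \<le> real n" using i by simp
    also have "\<dots> \<le> X n / a" by (rule index_le_X)
    also have "\<dots> = 1 / a * (of_int u * Y)" by (simp add: X_def Y_def xn n)
    also have "of_int u = (of_int u powr (e - 1)) powr (1 / (e - 1))"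
      using up e1 by (simp add: powr_powr)
    also have "1 / a * ((of_int u powr (e - 1)) powr (1 / (e - 1)) * Y)
        \<le> 1 / a * (Y powr (1 / (e - 1)) * Y)"
      using uY e1 ab Y8 by (intro mult_left_mono mult_right_mono powr_mono2) auto
    also have "\<dots> = 1 / a * Y powr \<sigma>" using Y8 by (simp add: \<sigma>_def powr_add)
    finally show "\<exists>n Y. M \<le> Y \<and> 1 / 4 * Y \<le> \<bar>of_int (f n)\<bar> \<and> real n \<le> 1 / a * Y powr \<sigma>"
      using i(2) Y8 by blast
  qed (use ab in auto)
qed

text \<open>If \<open>v (n + 1) = (u', v') + l * v n\<close>, then \<open>2 * l\<close> and \<open>K (n - 1)\<close> both equal
  \<open>2 / x n + O(1)\<close>, so the large terms cancel in \<open>f n + f (n - 1)\<close>.\<close>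

lemma f_average:
  assumes B: "farey_basis u v u' v'" and h: "0 < ht u v" "ht u v \<le> 1" "ht u' v' < 0" "- ht u' v' \<le> ht u v"
  obtains n g where "0 < n" "q n = u" "p n = v" "stern_brocot u v u' v' g"
    "\<bar>f n + f (n - 1) - 2 * g\<bar> \<le> 6"
proof -
  have "1 \<le> u" using farey_basis_pos[OF B] by simp
  then obtain n where n: "0 < n" "q n = u" "p n = v"
    using orbit_complete[OF _ farey_basis_coprime(1)[OF B] h(1,2)] by blast
  then obtain m where m: "n = Suc m" using gr0_implies_Suc by blast
  have xn: "x n = ht u v" by (simp add: x_eq_ht n)
  have d: "u * p (Suc n) - q (Suc n) * v = 1" using det[of n] n by simp
  have d': "u * v' - u' * v = 1" "0 \<le> u'" "0 \<le> v'" using B by (auto simp: farey_basis_def)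
  \<comment> \<open>\<open>(u', v')\<close> and the next orbit vector both have determinant 1 with
    \<open>(u, v)\<close>, so they differ by a multiple of it.\<close>
  have e: "u * (p (Suc n) - v') = (q (Suc n) - u') * v" using d d' by (simp add: algebra_simps)
  then have "u dvd (q (Suc n) - u') * v" by (metis dvd_triv_left)
  then have "u dvd q (Suc n) - u'"
    using farey_basis_coprime(1)[OF B] by (simp add: coprime_dvd_mult_left_iff)
  then obtain l where l: "q (Suc n) - u' = l * u" by (metis dvd_def mult.commute)
  have "u * (p (Suc n) - v') = u * (l * v)" using e l by simp
  then have "p (Suc n) - v' = l * v" using \<open>1 \<le> u\<close> by simp
  then have S: "q (Suc n) = u' + l * u" "p (Suc n) = v' + l * v" using l by auto
  have xS: "x (Suc n) = ht u' v' + of_int l * ht u v"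
    unfolding x_eq_ht S by (simp only: ht_add ht_mult)
  have "0 < of_int l * ht u v" using xS x_pos[of "Suc n"] h by linarith
  then have l0: "0 \<le> l" using h by (simp add: zero_less_mult_iff)
  have "stern_brocot u v (u' + l * u) (v' + l * v) (f n)"
    using stern_brocot_f[OF n(1)] n S by simp
  from stern_brocot_left_iter_inv[OF l0 this d'(2,3)]
  have sb: "stern_brocot u v u' v' (f n - l)" .
  have "of_int (2 * l - K m) * ht u v = x (Suc n) - x m - 2 * ht u' v'"
    using x_Suc_Suc[of m] xS m xn by (simp add: algebra_simps)
  \<comment> \<open>Both entries lie between \<open>1 - x n\<close> and 1.\<close>
  moreover have "\<bar>x (Suc n) - x m\<bar> \<le> ht u v"
    using x_add_Suc[of m] x_add_Suc[of n] x_le_1[of m] x_le_1[of "Suc n"] m xn by simp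
  ultimately have "\<bar>of_int (2 * l - K m) * ht u v\<bar> \<le> 3 * ht u v" using h by linarith
  then have "\<bar>real_of_int (2 * l - K m)\<bar> * ht u v \<le> 3 * ht u v" using h by (simp add: abs_mult)
  then have "\<bar>real_of_int (2 * l - K m)\<bar> \<le> 3" using h by simp
  then have "\<bar>2 * l - K m\<bar> \<le> 3" by linarith
  then have "\<bar>f n + f (n - 1) - 2 * (f n - l)\<bar> \<le> 6" by (simp add: m f_Suc)
  then show ?thesis using n sb that by blast
qed

lemma left_neighbour:
  assumes "coprime u v" "1 \<le> u" "1 \<le> v"
  obtains u' v' where "farey_basis u' v' u v" "1 \<le> u'" "u' \<le> u"
proof -
  obtain r s where "r * u + s * v = gcd u v" using bezout_int by blast
  then have rs: "r * u + s * v = 1" using assms(1) by simp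
  \<comment> \<open>The residue is taken between 1 and \<open>u\<close>, so that \<open>u'\<close>
    is positive even for \<open>u = 1\<close>.\<close>
  define u' where "u' = (s - 1) mod u + 1"
  define k where "k = (s - 1) div u"
  have "s - 1 = k * u + (s - 1) mod u" by (simp add: k_def)
  then have s: "s = k * u + u'" unfolding u'_def by linarith
  have "0 \<le> (s - 1) mod u" "(s - 1) mod u < u" using assms(2) by simp_all
  then have u': "1 \<le> u'" "u' \<le> u" unfolding u'_def by linarith+
  define v' where "v' = - r - k * v"
  have d: "u' * v - u * v' = 1" using rs by (simp add: v'_def s algebra_simps)
  have "1 * 1 \<le> u' * v" using u' assms by (intro mult_mono) auto
  then have "0 \<le> u * v'" using d by simp
  then have "0 \<le> v'" using assms by (simp add: zero_le_mult_iff)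
  then have "farey_basis u' v' u v" using d u' assms by (simp add: farey_basis_def)
  then show ?thesis using u' that by blast
qed

text \<open>A good approximation from above is a pivot of height \<open>- \<eta>\<close>. From its
  left neighbour, of height about \<open>a / u\<close>, a run of \<open>j\<close> right moves lowers
  the counter by \<open>j\<close>, which \<open>f_average\<close> makes visible in \<open>f\<close>
  near one of the two ends. Both indices are \<open>O(j * u\<^sup>2)\<close>, and
  \<open>u\<^sup>2\<close> is at most of order \<open>j powr (2 / (e - 2))\<close>.\<close>

lemma limsup_lower_even:
  assumes t: "0 < t" "ereal t < exponent_ratio 2 (even_dioph_exponent (b / a))"
  shows "ereal t \<le> limsup (\<lambda>n. log_abs (of_int (f n)) / ereal (ln (real n)))"
proof -
  have "- (b / a) \<notin> \<rat>" using irrational by simp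
  from less_exponent_ratio_imp[of t 2, OF _ _ odd_dioph_exponent_ge_1[OF this]] t
  have t1: "t < 1" and "ereal (2 / (1 - t)) < odd_dioph_exponent (- (b / a))"
    by (auto simp: even_dioph_exponent_eq)
  then obtain e where e: "2 / (1 - t) < e"
    and ap: "\<And>N. \<exists>u v. N < u \<and> 1 \<le> u \<and> coprime u v \<and> 0 < of_int u * (- (b / a)) - of_int v \<and>
      of_int u * (- (b / a)) - of_int v < of_int u powr (1 - e)"
    by (elim less_odd_dioph_exponent) auto
  have "2 < 2 / (1 - t)" using t t1 by (simp add: field_simps)
  then have e2: "2 < e" using e by linarith
  define \<sigma> where "\<sigma> = 1 + 2 / (e - 2)"
  have "2 < e * (1 - t)" using e t1 by (simp add: field_simps)
  then have ts: "t * \<sigma> < 1" using e2 by (simp add: \<sigma>_def field_simps)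
  define C where "C = 8 / a\<^sup>2 * 8 powr (2 / (e - 2))"
  show ?thesis
  proof (rule le_limsup_log_criterion[OF t(1) ts, of "1 / 4" C])
    fix M :: real
    \<comment> \<open>As \<open>j \<ge> P / 4 - 1\<close> below, \<open>P \<ge> 100\<close> gives
      \<open>j \<ge> 12\<close> and \<open>j \<ge> P / 8\<close>, hence
      \<open>j \<ge> M\<close>.\<close>
    define R where "R = max (8 * M) 100"
    obtain u v0 where u: "\<lceil>R powr (1 / (e - 2))\<rceil> < u" "1 \<le> u" "coprime u v0"
      "0 < of_int u * (- (b / a)) - of_int v0"
      "of_int u * (- (b / a)) - of_int v0 < of_int u powr (1 - e)"
      using ap by blast
    define v where "v = - v0"
    have up: "0 < real_of_int u" using u by simp
    define \<eta> where "\<eta> = - ht u v"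
    have \<eta>_eq: "\<eta> = a * (of_int u * (- (b / a)) - of_int v0)"
      unfolding \<eta>_def ht_eq v_def by (simp add: algebra_simps)
    have \<eta>0: "0 < \<eta>" unfolding \<eta>_eq using u(4) ab by (intro mult_pos_pos) auto
    have \<eta>1: "\<eta> \<le> a * of_int u powr (1 - e)"
      unfolding \<eta>_eq using u(5) ab by (intro mult_left_mono) auto
    define P where "P = of_int u powr (e - 2)"
    have "R powr (1 / (e - 2)) \<le> of_int u" using u(1) by linarith
    then have "(R powr (1 / (e - 2))) powr (e - 2) \<le> P"
      unfolding P_def using e2 by (intro powr_mono2) auto
    moreover have "(R powr (1 / (e - 2))) powr (e - 2) = R" using e2 by (simp add: powr_powr R_def)
    ultimately have RP: "R \<le> P" by simp
    then have P: "100 \<le> P" "8 * M \<le> P" by (auto simp: R_def)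
    have uP: "of_int u * of_int u powr (1 - e) = 1 / P"
    proof -
      have "of_int u powr (1 - e) = of_int u powr (- 1 - (e - 2))" by (simp add: algebra_simps)
      also have "\<dots> = 1 / (of_int u * P)"
        unfolding P_def using up by (simp add: powr_diff powr_minus field_simps power2_eq_square)
      finally show ?thesis using up by simp
    qed
    have u\<eta>: "of_int u * \<eta> \<le> a / P"
    proof -
      have "of_int u * \<eta> \<le> of_int u * (a * of_int u powr (1 - e))"
        using \<eta>1 up by (intro mult_left_mono) auto
      also have "\<dots> = a * (of_int u * of_int u powr (1 - e))" by simp
      finally show ?thesis unfolding uP by simp
    qed
    have "0 < of_int v * a"
    proof -
      have "of_int v * a = of_int u * b + \<eta>" by (simp add: \<eta>_def ht_def)
      then show ?thesis using up ab \<eta>0 by (simp add: add_pos_pos)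
    qed
    then have "1 \<le> v" using ab by (simp add: zero_less_mult_iff)
    moreover have "coprime u v" using u(3) by (simp add: v_def)
    ultimately obtain u1 v1 where B1: "farey_basis u1 v1 u v" "1 \<le> u1" "u1 \<le> u"
      using left_neighbour u(2) by blast
    define h1 where "h1 = ht u1 v1"
    \<comment> \<open>Determinant identity; as
      \<open>u1 * \<eta> \<le> u * \<eta> \<le> a / 100\<close>, it places \<open>h1\<close> between
      \<open>a / (2 * u)\<close> and \<open>a / u\<close>.\<close>
    have hu: "of_int u * h1 + of_int u1 * \<eta> = a"
    proof -
      have d: "u1 * v - u * v1 = 1" using B1(1) by (simp add: farey_basis_def)
      show ?thesis using ht_cross[of u u1 v1 v] unfolding d by (simp add: h1_def \<eta>_def)
    qed
    have u1\<eta>: "of_int u1 * \<eta> \<le> of_int u * \<eta>" using B1 \<eta>0 by (intro mult_right_mono) auto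
    have aP: "a / P \<le> a / 100" using P ab by (intro divide_left_mono) auto
    have hlow: "a \<le> 2 * (of_int u * h1)" using hu u1\<eta> u\<eta> aP ab by linarith
    have "0 \<le> of_int u1 * \<eta>" using B1 \<eta>0 by simp
    then have hup: "of_int u * h1 \<le> a" using hu by linarith
    have "0 < of_int u * h1" using hlow ab by linarith
    then have h10: "0 < h1" using up by (simp add: zero_less_mult_iff)
    have h11: "h1 \<le> 1"
    proof -
      have "1 * h1 \<le> of_int u * h1" using h10 u(2) by (intro mult_right_mono) auto
      then show ?thesis using hup ab by linarith
    qed
    \<comment> \<open>About half of the moves that the height \<open>h1\<close> allows: the end
      vector keeps height at least \<open>h1 / 2\<close>, which bounds its index and lets
      \<open>f_average\<close> apply.\<close>
    define j where "j = \<lfloor>h1 / (2 * \<eta>)\<rfloor>"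
    have Pj: "P / 4 \<le> h1 / (2 * \<eta>)"
    proof -
      have "P * (of_int u * \<eta>) \<le> P * (a / P)" using u\<eta> P by (intro mult_left_mono) auto
      then have "P * (of_int u * \<eta>) \<le> 2 * (of_int u * h1)" using P hlow by simp
      then have "of_int u * (P * \<eta>) \<le> of_int u * (2 * h1)" by (simp add: ac_simps)
      then have "P * \<eta> \<le> 2 * h1" using up by simp
      then show ?thesis using \<eta>0 by (simp add: field_simps)
    qed
    then have jP: "P / 4 - 1 \<le> of_int j" unfolding j_def by linarith
    have j12: "12 \<le> j" using jP P by linarith
    have jM: "M \<le> of_int j" using jP P by linarith
    have Pj8: "P \<le> 8 * of_int j" using jP P by linarith
    have "of_int j \<le> h1 / (2 * \<eta>)" unfolding j_def by linarith
    then have j\<eta>: "of_int j * \<eta> \<le> h1 / 2" using \<eta>0 by (simp add: field_simps)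
    have \<eta>h: "\<eta> \<le> h1 / 2"
    proof -
      have "1 * \<eta> \<le> of_int j * \<eta>" using j12 \<eta>0 by (intro mult_right_mono) auto
      then show ?thesis using j\<eta> by simp
    qed
    define u2 where "u2 = u1 + j * u"
    define v2 where "v2 = v1 + j * v"
    have B2: "farey_basis u2 v2 u v"
      using B1 j12 by (auto simp: farey_basis_def u2_def v2_def algebra_simps)
    have h2: "ht u2 v2 = h1 - of_int j * \<eta>"
      unfolding u2_def v2_def ht_add ht_mult by (simp add: h1_def \<eta>_def)
    have j\<eta>0: "0 \<le> of_int j * \<eta>" using j12 \<eta>0 by simp
    obtain n1 g1 where n1: "0 < n1" "q n1 = u1" "p n1 = v1" "stern_brocot u1 v1 u v g1"
      "\<bar>f n1 + f (n1 - 1) - 2 * g1\<bar> \<le> 6"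
      by (rule f_average[OF B1(1)]) (use h10 h11 \<eta>0 \<eta>h in \<open>auto simp: h1_def \<eta>_def\<close>)
    obtain n2 g2 where n2: "0 < n2" "q n2 = u2" "p n2 = v2" "stern_brocot u2 v2 u v g2"
      "\<bar>f n2 + f (n2 - 1) - 2 * g2\<bar> \<le> 6"
    proof (rule f_average[OF B2])
      show "0 < ht u2 v2" "ht u2 v2 \<le> 1" unfolding h2 using j\<eta> j\<eta>0 h10 h11 by linarith+
      show "ht u v < 0" using \<eta>0 by (simp add: \<eta>_def)
      show "- ht u v \<le> ht u2 v2" unfolding h2 using j\<eta> \<eta>h by (simp add: \<eta>_def)
    qed blast
    have "stern_brocot u1 v1 u v (g2 + j)"
      using stern_brocot_right_iter_inv[of j u1 u v1 v g2] n2(4) B1(1) j12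
      by (simp add: u2_def v2_def farey_basis_def)
    then have g: "g1 = g2 + j" using n1(4) stern_brocot_unique by blast
    define F where "F i = \<bar>f i\<bar>" for i
    have "2 * g1 \<le> F n1 + F (n1 - 1) + 6" unfolding F_def using n1(5) by linarith
    moreover have "- (2 * g2) \<le> F n2 + F (n2 - 1) + 6" unfolding F_def using n2(5) by linarith
    \<comment> \<open>Adding up, \<open>2 * j\<close> is at most the four absolute values plus 12,
      so one of them is at least \<open>j / 4\<close> once \<open>j \<ge> 12\<close>.\<close>
    ultimately have "j \<le> 4 * F n1 \<or> j \<le> 4 * F (n1 - 1) \<or> j \<le> 4 * F n2 \<or> j \<le> 4 * F (n2 - 1)"
      using g j12 by linarith
    then have "\<exists>i. (i \<le> n1 \<or> i \<le> n2) \<and> j \<le> 4 * F i"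
      using diff_le_self by blast
    then obtain i where i: "i \<le> n1 \<or> i \<le> n2" "j \<le> 4 * \<bar>f i\<bar>" unfolding F_def by blast
    define Y where "Y = real_of_int j"
    have Y: "12 \<le> Y" using j12 by (simp add: Y_def)
    \<comment> \<open>The index is at most \<open>X m / a\<close>, and
      \<open>x m \<ge> h1 / 2 \<ge> a / (4 * u)\<close>.\<close>
    have ub: "real m \<le> 8 / a\<^sup>2 * (Y * (of_int u)\<^sup>2)"
      if "of_int (q m) \<le> 2 * Y * of_int u" "h1 / 2 \<le> x m" for m
    proof -
      have "of_int u * h1 \<le> of_int u * (2 * x m)" using that(2) up by (intro mult_left_mono) auto
      then have "a \<le> 2 * (of_int u * (2 * x m))" using hlow by linarith
      also have "\<dots> = x m * (4 * of_int u)" by simp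
      finally have "a \<le> x m * (4 * of_int u)" .
      then have "a / (4 * of_int u) \<le> x m" using up by (simp add: pos_divide_le_eq)
      have "real m \<le> of_int (q m) / x m / a" using index_le_X[of m] by (simp add: X_def)
      also have "\<dots> \<le> (2 * Y * of_int u) / (a / (4 * of_int u)) / a"
        using that(1) \<open>a / (4 * of_int u) \<le> x m\<close> ab up q_nonneg[of m] Y
        by (intro divide_right_mono frac_le) auto
      also have "\<dots> = 8 / a\<^sup>2 * (Y * (of_int u)\<^sup>2)" using ab up by (simp add: field_simps power2_eq_square)
      finally show ?thesis .
    qed
    have Yu: "of_int u \<le> Y * of_int u" using Y up by simp
    have "real n1 \<le> 8 / a\<^sup>2 * (Y * (of_int u)\<^sup>2)"
    proof (rule ub)
      have "real_of_int u1 \<le> of_int u" using B1 by simp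
      then show "of_int (q n1) \<le> 2 * Y * of_int u" unfolding n1(2) using Yu up by linarith
      show "h1 / 2 \<le> x n1" using h10 by (simp add: x_eq_ht n1 h1_def)
    qed
    moreover have "real n2 \<le> 8 / a\<^sup>2 * (Y * (of_int u)\<^sup>2)"
    proof (rule ub)
      have "real_of_int u1 \<le> of_int u" using B1 by simp
      then show "of_int (q n2) \<le> 2 * Y * of_int u" using Yu by (simp add: n2 u2_def Y_def)
      show "h1 / 2 \<le> x n2" using j\<eta> by (simp add: x_eq_ht n2 h2)
    qed
    ultimately have "real i \<le> 8 / a\<^sup>2 * (Y * (of_int u)\<^sup>2)" using i(1) by auto
    also have "\<dots> \<le> 8 / a\<^sup>2 * (Y * (8 * Y) powr (2 / (e - 2)))"
    proof -
      have "(of_int u)\<^sup>2 = P powr (2 / (e - 2))"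
      proof -
        have "(e - 2) * (2 / (e - 2)) = 2" using e2 by (simp add: field_simps)
        then show ?thesis unfolding P_def powr_powr using up by (simp only: powr_numeral)
      qed
      also have "\<dots> \<le> (8 * Y) powr (2 / (e - 2))"
        using Pj8 P e2 by (intro powr_mono2) (auto simp: Y_def)
      finally show ?thesis using ab Y by (intro mult_left_mono) auto
    qed
    also have "\<dots> = C * Y powr \<sigma>" using Y by (simp add: C_def \<sigma>_def powr_add powr_mult)
    finally have "real i \<le> C * Y powr \<sigma>" .
    moreover have "1 / 4 * Y \<le> \<bar>of_int (f i)\<bar>"
    proof -
      have "real_of_int j \<le> real_of_int (4 * \<bar>f i\<bar>)" using i(2) by (simp only: of_int_le_iff)
      then show ?thesis by (simp add: Y_def)
    qed
    ultimately show "\<exists>n Y. M \<le> Y \<and> 1 / 4 * Y \<le> \<bar>of_int (f n)\<bar> \<and> real n \<le> C * Y powr \<sigma>"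
      using jM by (auto simp: Y_def)
  qed (use ab in \<open>auto simp: C_def\<close>)
qed

section \<open>The value of the limsup\<close>

text \<open>Follows from \<open>e \<ge> 1\<close>. Every real above the maximum is then positive, as
  the run bounds require.\<close>

lemma exponent_ratio_odd_nonneg: "0 \<le> exponent_ratio 1 (odd_dioph_exponent (b / a))"
proof (rule ccontr)
  assume "\<not> ?thesis"
  then have "exponent_ratio (ereal 1) (odd_dioph_exponent (b / a)) < ereal 0"
    by (simp add: one_ereal_def zero_ereal_def not_le)
  from exponent_ratio_less_imp[OF this _ odd_dioph_exponent_ge_1[OF irrational]]
  show False using odd_dioph_exponent_ge_1[OF irrational] by (simp add: one_ereal_def)
qed

lemma limsup_eq:
  "limsup (\<lambda>n. log_abs (of_int (f n)) / ereal (ln (real n))) =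
    max (exponent_ratio 1 (odd_dioph_exponent (b / a)))
        (exponent_ratio 2 (even_dioph_exponent (b / a)))" (is "?L = ?R")
proof (rule antisym)
  show "?L \<le> ?R"
  proof (rule ccontr)
    assume "\<not> ?L \<le> ?R"
    then have "?R < ?L" by (simp only: not_le)
    from ereal_dense2[OF this] obtain r where r: "?R < ereal r" "ereal r < ?L" by blast
    \<comment> \<open>A second real in between, because absorbing the logarithm costs part of the
      exponent.\<close>
    from ereal_dense2[OF r(1)] obtain s where s: "?R < ereal s" "ereal s < ereal r" by blast
    have "0 \<le> ?R" using exponent_ratio_odd_nonneg by (rule max.coboundedI1)
    then have "0 < ereal s" using s(1) by (rule le_less_trans)
    then have "?L \<le> ereal r" using s by (intro limsup_upper[of s]) auto
    then show False using r by simp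
  qed
  show "?R \<le> ?L"
  proof (rule ccontr)
    assume "\<not> ?R \<le> ?L"
    then have "?L < ?R" by (simp only: not_le)
    from ereal_dense2[OF this] obtain r where r: "?L < ereal r" "ereal r < ?R" by blast
    have "0 < ereal r" using limsup_nonneg r(1) by (rule le_less_trans)
    then have "ereal r \<le> ?L"
      using r(2) limsup_lower_odd[of r] limsup_lower_even[of r] by (auto simp: less_max_iff_disj)
    then show False using r by simp
  qed
qed

end

theorem theorem1p2:
  fixes a b :: real
  assumes "(a, b) \<in> farey_triangle" and "b / a \<notin> \<rat>"
  shows "limsup (\<lambda>n. log_abs (of_int (bcz_sum (a, b) n)) / ereal (ln (real n))) =
         max (exponent_ratio 1 (odd_dioph_exponent (b / a)))
             (exponent_ratio 2 (even_dioph_exponent (b / a)))"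
proof -
  interpret bcz_orbit a b using assms by unfold_locales
  show ?thesis unfolding bcz_sum_eq by (rule limsup_eq)
qed

end
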